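(* For every admissible triple $(a,b,c)$ let $\mathfrak{p}_{a,b,c}\in\mathbb{C}[t_1,t_2,t_3]$ be the polynomial with $\chi^{a,b,c}(\mathbf{x}_1,\mathbf{x}_2)=\mathfrak{p}_{a,b,c}\big(\mathrm{tr}(\mathbf{x}_2),\mathrm{tr}(\mathbf{x}_1),\mathrm{tr}(\mathbf{x}_1\mathbf{x}_2^{-1})\big)$ for all $(\mathbf{x}_1,\mathbf{x}_2)\in \mathrm{SL}(2,\mathbb{C})\times \mathrm{SL}(2,\mathbb{C})$. Then for every admissible triple $(a,b,c)$ and every permutation $\sigma\in\Sigma_3$, the following identity holds in $\mathbb{C}[y,x,z]$: $$\mathfrak{p}_{\sigma(a,b,c)}(y,x,z)=\mathfrak{p}_{a,b,c}\big(\sigma^{-1}(y,x,z)\big).$$ Here, for an ordered triple, $\sigma(d_1,d_2,d_3)=(d_{\sigma(1)},d_{\sigma(2)},d_{\sigma(3)})$.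
   Context: Let $G=\mathrm{SL}(2,\mathbb{C})$ and $V=\mathbb{C}^2$ with standard basis $e_1,e_2$. A triple $(a,b,c)$ of nonnegative integers is admissible if $\alpha=\tfrac12(-a+b+c)$, $\beta=\tfrac12(a-b+c)$, $\gamma=\tfrac12(a+b-c)$ are all nonnegative integers. Let $P_n:V^{\otimes n}\to V^{\otimes n}$ be the symmetrizer $v_1\otimes\cdots\otimes v_n\mapsto\frac1{n!}\sum_{\sigma\in\Sigma_n}v_{\sigma(1)}\otimes\cdots\otimes v_{\sigma(n)}$, and let $V_n\subset V^{\otimes n}$ be its image (isomorphic to $\mathrm{Sym}^nV$). Let $\mathrm{cup}:\mathbb{C}\to V\otimes V$, $1\mapsto e_1\otimes e_2-e_2\otimes e_1$, and $\mathrm{cap}:V\otimes V\to\mathbb{C}$, $v\otimes w\mapsto\det[v\ w]$. Define nested versions $\mathrm{cup}_n:\mathbb{C}\to V^{\otimes n}\otimes V^{\otimes n}$ and $\mathrm{cap}_n:V^{\otimes n}\otimes V^{\otimes n}\to\mathbb{C}$ by $\mathrm{cup}_0=\mathrm{cap}_0=1$, $\mathrm{cup}_n=(\mathrm{id}_{V^{\otimes (n-1)}}\otimes\mathrm{cup}\otimes\mathrm{id}_{V^{\otimes (n-1)}})\circ\mathrm{cup}_{n-1}$, $\mathrm{cap}_n=\mathrm{cap}_{n-1}\circ(\mathrm{id}_{V^{\otimes (n-1)}}\otimes\mathrm{cap}\otimes\mathrm{id}_{V^{\otimes (n-1)}})$. For an admissible triple define the $G$-equivariant maps $$\iota^{a,b}_c=(P_a\otimes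 P_b)\circ(\mathrm{id}_{V^{\otimes\beta}}\otimes\mathrm{cup}_\gamma\otimes\mathrm{id}_{V^{\otimes\alpha}})|_{V_c}:V_c\to V_a\otimes V_b,$$ $$\pi^c_{a,b}=P_c\circ(\mathrm{id}_{V^{\otimes\beta}}\otimes\mathrm{cap}_\gamma\otimes\mathrm{id}_{V^{\otimes\alpha}})|_{V_a\otimes V_b}:V_a\otimes V_b\to V_c.$$ The central function $\chi^{a,b,c}:G\times G\to\mathbb{C}$ is $\chi^{a,b,c}(\mathbf{x}_1,\mathbf{x}_2)=\mathrm{tr}_{V_c}\big(\pi^c_{a,b}\circ(\mathbf{x}_1^{\otimes a}\otimes\mathbf{x}_2^{\otimes b})\circ\iota^{a,b}_c\big)$. It is known that for each admissible triple there is a unique polynomial $\mathfrak{p}_{a,b,c}$ with the property stated in the claim. Admissibility is invariant under permuting $a,b,c$. *)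

theory Defs
  imports
    "HOL-Analysis.Analysis"
    "HOL-Library.Function_Algebras"
    "HOL-Library.Poly_Mapping"
begin

section \<open>Tensor powers of the plane\<close>

text \<open>
  A tensor is given by its coordinates with respect to the standard basis of the tensor algebra
  of \<open>V = \<complex>\<^sup>2\<close>, which consists of the words in the two basis vectors: the word
  \<open>[i\<^sub>1, \<dots>, i\<^sub>n]\<close> stands for the tensor product of \<open>e\<close> at \<open>i\<^sub>1\<close>, \dots, \<open>e\<close> at \<open>i\<^sub>n\<close>.
  The tensor power of degree \<open>n\<close> consists of the functions supported on words of length \<open>n\<close>.
  In this model the identification of \<open>V\<^sup>m \<otimes> V\<^sup>n\<close> with \<open>V\<^sup>m\<^sup>+\<^sup>n\<close> is an equality,
  and the ground field is the tensor power of degree 0.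
\<close>

type_synonym tensor = "2 list \<Rightarrow> complex"

definition tscale :: "complex \<Rightarrow> tensor \<Rightarrow> tensor" where
  "tscale k t = (\<lambda>w. k * t w)"

global_interpretation tensor: vector_space tscale
  by unfold_locales (auto simp: tscale_def algebra_simps)

definition tensor_power :: "nat \<Rightarrow> tensor set" where
  "tensor_power n = {t. \<forall>w. t w \<noteq> 0 \<longrightarrow> length w = n}"

definition pure_tensor :: "(complex ^ 2) list \<Rightarrow> tensor" where
  "pure_tensor vs = (\<lambda>w. if length w = length vs then \<Prod>i<length vs. (vs ! i) $ (w ! i) else 0)"

definition basis_vec :: "2 \<Rightarrow> complex ^ 2" where
  "basis_vec i = axis i 1"

text \<open>Multiplication of the tensor algebra; on tensors that are homogeneous of degrees \<open>m\<close> and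
  \<open>n\<close>, only the summand \<open>k = m\<close> contributes.\<close>

definition tensor_mult :: "tensor \<Rightarrow> tensor \<Rightarrow> tensor" where
  "tensor_mult s t = (\<lambda>w. \<Sum>k\<le>length w. s (take k w) * t (drop k w))"

text \<open>The linear map on the tensor power of degree \<open>n\<close> that sends a pure tensor with factors
  \<open>vs\<close> to \<open>F vs\<close>, provided that \<open>F\<close> is multilinear in the \<open>n\<close> entries of \<open>vs\<close>.\<close>

definition multilinear_ext :: "nat \<Rightarrow> ((complex ^ 2) list \<Rightarrow> tensor) \<Rightarrow> tensor \<Rightarrow> tensor" where
  "multilinear_ext n F t = (\<Sum>w | length w = n. tscale (t w) (F (map basis_vec w)))"

text \<open>The tensor product of linear maps \<open>f\<close> and \<open>g\<close> whose domains are the tensor powers of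
  degrees \<open>m\<close> and \<open>n\<close>.\<close>

definition tensor_map :: "nat \<Rightarrow> nat \<Rightarrow> (tensor \<Rightarrow> tensor) \<Rightarrow> (tensor \<Rightarrow> tensor) \<Rightarrow> tensor \<Rightarrow> tensor" where
  "tensor_map m n f g = multilinear_ext (m + n)
     (\<lambda>vs. tensor_mult (f (pure_tensor (take m vs))) (g (pure_tensor (drop m vs))))"

text \<open>The identity on degree \<open>l\<close>, tensored with a map \<open>f\<close> with domain of degree \<open>m\<close>,
  tensored with the identity on degree \<open>n\<close>.\<close>

definition tensor_map_mid :: "nat \<Rightarrow> nat \<Rightarrow> nat \<Rightarrow> (tensor \<Rightarrow> tensor) \<Rightarrow> tensor \<Rightarrow> tensor" where
  "tensor_map_mid l m n f = tensor_map l (m + n) id (tensor_map m n f id)"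

definition matrix_tensor_power :: "nat \<Rightarrow> complex ^ 2 ^ 2 \<Rightarrow> tensor \<Rightarrow> tensor" where
  "matrix_tensor_power n x = multilinear_ext n (\<lambda>vs. pure_tensor (map (\<lambda>v. x *v v) vs))"

definition symmetrizer :: "nat \<Rightarrow> tensor \<Rightarrow> tensor" where
  "symmetrizer n = multilinear_ext n (\<lambda>vs.
     tscale (1 / fact n) (\<Sum>\<sigma> | \<sigma> permutes {..<n}. pure_tensor (map (\<lambda>i. vs ! \<sigma> i) [0..<n])))"

definition sym_power :: "nat \<Rightarrow> tensor set" where
  "sym_power n = symmetrizer n ` tensor_power n"

definition cup :: "tensor \<Rightarrow> tensor" where
  "cup = multilinear_ext 0 (\<lambda>_.
     pure_tensor [basis_vec 1, basis_vec 2] - pure_tensor [basis_vec 2, basis_vec 1])"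

text \<open>\<open>vector [v, w]\<close> is the matrix with rows \<open>v\<close> and \<open>w\<close>; \<open>pure_tensor []\<close> is the unit of the
  ground field.\<close>

definition cap :: "tensor \<Rightarrow> tensor" where
  "cap = multilinear_ext 2 (\<lambda>vs.
     tscale (det (transpose (vector [vs ! 0, vs ! 1] :: complex ^ 2 ^ 2))) (pure_tensor []))"

fun nested_cup :: "nat \<Rightarrow> tensor \<Rightarrow> tensor" where
  "nested_cup 0 = id"
| "nested_cup (Suc n) = tensor_map_mid n 0 n cup \<circ> nested_cup n"

fun nested_cap :: "nat \<Rightarrow> tensor \<Rightarrow> tensor" where
  "nested_cap 0 = id"
| "nested_cap (Suc n) = nested_cap n \<circ> tensor_map_mid n 2 n cap"

text \<open>The trace of a linear endomorphism of a finite-dimensional subspace, computed in an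
  arbitrary basis of that subspace.\<close>

definition subspace_trace :: "tensor set \<Rightarrow> (tensor \<Rightarrow> tensor) \<Rightarrow> complex" where
  "subspace_trace S f =
     (let B = (SOME B. tensor.independent B \<and> tensor.span B = S)
      in \<Sum>b\<in>B. tensor.representation B (f b) b)"


section \<open>Central functions\<close>

definition admissible :: "nat \<Rightarrow> nat \<Rightarrow> nat \<Rightarrow> bool" where
  "admissible a b c \<longleftrightarrow>
     (- real a + real b + real c) / 2 \<in> \<nat> \<and>
     (real a - real b + real c) / 2 \<in> \<nat> \<and>
     (real a + real b - real c) / 2 \<in> \<nat>"

text \<open>For an admissible triple, \<open>\<alpha> = (b + c - a) div 2\<close>, \<open>\<beta> = (a + c - b) div 2\<close> and
  \<open>\<gamma> = (a + b - c) div 2\<close>, with neither the subtractions nor the divisions truncating.\<close>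

definition inj_map :: "nat \<Rightarrow> nat \<Rightarrow> nat \<Rightarrow> tensor \<Rightarrow> tensor" where
  "inj_map a b c =
     (let \<alpha> = (b + c - a) div 2; \<beta> = (a + c - b) div 2; \<gamma> = (a + b - c) div 2
      in tensor_map a b (symmetrizer a) (symmetrizer b) \<circ> tensor_map_mid \<beta> 0 \<alpha> (nested_cup \<gamma>))"

definition proj_map :: "nat \<Rightarrow> nat \<Rightarrow> nat \<Rightarrow> tensor \<Rightarrow> tensor" where
  "proj_map a b c =
     (let \<alpha> = (b + c - a) div 2; \<beta> = (a + c - b) div 2; \<gamma> = (a + b - c) div 2
      in symmetrizer c \<circ> tensor_map_mid \<beta> (2 * \<gamma>) \<alpha> (nested_cap \<gamma>))"

definition SL2 :: "(complex ^ 2 ^ 2) set" where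
  "SL2 = {x. det x = 1}"

definition central_function ::
  "nat \<Rightarrow> nat \<Rightarrow> nat \<Rightarrow> complex ^ 2 ^ 2 \<Rightarrow> complex ^ 2 ^ 2 \<Rightarrow> complex" where
  "central_function a b c x1 x2 = subspace_trace (sym_power c)
     (proj_map a b c \<circ>
      tensor_map a b (matrix_tensor_power a x1) (matrix_tensor_power b x2) \<circ>
      inj_map a b c)"


section \<open>Polynomials in three variables\<close>

text \<open>The numeral type \<open>3\<close> has exactly the elements 1, 2 and 3 (with \<open>3 = 0\<close>).\<close>

type_synonym poly3 = "(3 \<Rightarrow>\<^sub>0 nat) \<Rightarrow>\<^sub>0 complex"

definition Var :: "3 \<Rightarrow> poly3" where
  "Var i = Poly_Mapping.single (Poly_Mapping.single i 1) 1"

definition Const :: "complex \<Rightarrow> poly3" where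
  "Const k = Poly_Mapping.single 0 k"

text \<open>Evaluation at a triple of elements of a commutative \<open>\<complex>\<close>-algebra with structure map \<open>\<phi>\<close>.\<close>

definition eval_in :: "(complex \<Rightarrow> 'r::comm_ring_1) \<Rightarrow> poly3 \<Rightarrow> 'r ^ 3 \<Rightarrow> 'r" where
  "eval_in \<phi> p v = (\<Sum>m\<in>Poly_Mapping.keys p.
     \<phi> (Poly_Mapping.lookup p m) * (\<Prod>i\<in>UNIV. (v $ i) ^ Poly_Mapping.lookup m i))"

definition eval :: "poly3 \<Rightarrow> complex ^ 3 \<Rightarrow> complex" where
  "eval = eval_in id"

definition subst :: "poly3 \<Rightarrow> poly3 ^ 3 \<Rightarrow> poly3" where
  "subst = eval_in Const"

definition permute_triple :: "(3 \<Rightarrow> 3) \<Rightarrow> 'a ^ 3 \<Rightarrow> 'a ^ 3" where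
  "permute_triple \<sigma> d = (\<chi> i. d $ \<sigma> i)"

definition admissible_triple :: "nat ^ 3 \<Rightarrow> bool" where
  "admissible_triple d \<longleftrightarrow> admissible (d $ 1) (d $ 2) (d $ 3)"

definition represents_central_function :: "poly3 \<Rightarrow> nat ^ 3 \<Rightarrow> bool" where
  "represents_central_function p d \<longleftrightarrow>
     (\<forall>x1\<in>SL2. \<forall>x2\<in>SL2. central_function (d $ 1) (d $ 2) (d $ 3) x1 x2 =
        eval p (vector [trace x2, trace x1, trace (x1 ** matrix_inv x2)]))"

end

theory Submission
  imports Defs
begin

text \<open>
  The central function is the value of a closed diagram of theta shape: two trivalent vertices
  joined by three edges, which carry the symmetrizers of degrees \<open>a\<close>, \<open>b\<close>, \<open>c\<close>
  composed with powers of the matrices \<open>x\<^sub>1\<close>, \<open>x\<^sub>2\<close> and the identity. The edge of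
  degree \<open>c\<close> enters differently from the other two, because its strands run through the vertices
  instead of ending in cups and caps. Bending these strands back by the skew form
  \<open>\<epsilon> = cup = cap\<close> turns each vertex into three bundles of cups arranged cyclically,
  and the three edges then play the same role. This gives a function
  \<open>theta \<alpha> \<beta> \<gamma> X Y Z\<close> with one matrix on each edge, and
  \<open>central_function_eq_theta\<close> says that the central function is its value at
  \<open>(x\<^sub>1, x\<^sub>2, 1)\<close>. The signs that arise from the skewness of \<open>\<epsilon>\<close> occur once
  at each vertex and cancel.

  Three properties of \<open>theta\<close> carry the proof. Rotating the diagram permutes the edges cyclically
  (\<open>theta_cyclic\<close>). Reflecting it exchanges two edges, again with cancelling signs
  (\<open>theta_swap\<close>). Finally a vertex is invariant under \<open>SL(2, \<complex>)\<close>, as it is built from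
  \<open>\<epsilon>\<close>, so that a common left factor of the three matrices can be dropped
  (\<open>theta_mult_left\<close>). After a rotation the identity sits on the wrong edge; multiplication by
  \<open>x\<^sub>1\<close> inverse moves it back, at the price of replacing the pair \<open>(x\<^sub>1, x\<^sub>2)\<close>
  by the pair of \<open>x\<^sub>1\<close> inverse times \<open>x\<^sub>2\<close> and \<open>x\<^sub>1\<close> inverse.

  Since a matrix of determinant 1 has the same trace as its inverse, these two changes of
  \<open>(x\<^sub>1, x\<^sub>2)\<close> permute the three traces \<open>(y, x, z)\<close> in the same way as the degrees
  \<open>(a, b, c)\<close>. Every triple of complex numbers is a triple of such traces
  (\<open>exists_SL2_traces\<close>), so the polynomial functions
  agree on all of \<open>\<complex>\<^sup>3\<close> and hence the polynomials are equal. A transposition and a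
  3-cycle generate the symmetric group, which is all that remains.
\<close>

section \<open>Words and the entries of tensor powers of matrices\<close>

abbreviation words :: "nat \<Rightarrow> 2 list set" where
  "words n \<equiv> {w. length w = n}"

lemma finite_words [simp]: "finite (words n)"
  using finite_lists_length_eq[of "UNIV :: 2 set" n] by simp

lemma words_0: "words 0 = {[]}"
  by auto

lemma sum_words_append:
  "(\<Sum>w\<in>words (m + n). f w) = (\<Sum>s\<in>words m. \<Sum>t\<in>words n. f (s @ t))"
proof -
  have "(\<Sum>w\<in>words (m + n). f w) = (\<Sum>(s, t)\<in>words m \<times> words n. f (s @ t))"
    by (rule sum.reindex_bij_witness[where i = "\<lambda>(s, t). s @ t" and j = "\<lambda>w. (take m w, drop m w)"])
      auto
  then show ?thesis
    by (simp add: sum.cartesian_product)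
qed

lemma sum_words_Suc: "(\<Sum>w\<in>words (Suc n). f w) = (\<Sum>i\<in>UNIV. \<Sum>w\<in>words n. f (i # w))"
proof -
  have "(\<Sum>w\<in>words (Suc n). f w) = (\<Sum>(i, w)\<in>UNIV \<times> words n. f (i # w))"
    by (rule sum.reindex_bij_witness[where i = "\<lambda>(i, w). i # w" and j = "\<lambda>w. (hd w, tl w)"])
      (auto simp: length_Suc_conv)
  then show ?thesis
    by (simp add: sum.cartesian_product)
qed

lemma sum_words_rev: "(\<Sum>w\<in>words n. f (rev w)) = (\<Sum>w\<in>words n. f w)"
  by (rule sum.reindex_bij_witness[where i = rev and j = rev]) auto

text \<open>The matrix entry of the tensor power of \<open>X\<close> in row \<open>u\<close> and column \<open>w\<close>.\<close>

definition tensor_entry :: "complex ^ 2 ^ 2 \<Rightarrow> 2 list \<Rightarrow> 2 list \<Rightarrow> complex" where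
  "tensor_entry X u w = prod_list (map2 (\<lambda>i j. X $ i $ j) u w)"

lemma tensor_entry_Nil [simp]: "tensor_entry X [] w = 1" "tensor_entry X u [] = 1"
  by (simp_all add: tensor_entry_def)

lemma tensor_entry_Cons [simp]:
  "tensor_entry X (i # u) (j # w) = X $ i $ j * tensor_entry X u w"
  by (simp add: tensor_entry_def)

lemma tensor_entry_append:
  "length u = length w \<Longrightarrow>
    tensor_entry X (u @ u') (w @ w') = tensor_entry X u w * tensor_entry X u' w'"
  by (simp add: tensor_entry_def)

lemma tensor_entry_rev:
  "length u = length w \<Longrightarrow> tensor_entry X (rev u) (rev w) = tensor_entry X u w"
  by (induction u w rule: list_induct2) (simp_all add: tensor_entry_append)

lemma tensor_entry_transpose: "tensor_entry (transpose X) u w = tensor_entry X w u"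
  unfolding tensor_entry_def
  by (subst zip_commute) (simp add: transpose_def case_prod_unfold comp_def)

lemma tensor_entry_uminus:
  "length u = length w \<Longrightarrow> tensor_entry (- X) u w = (- 1) ^ length u * tensor_entry X u w"
  by (induction u w rule: list_induct2) simp_all

lemma tensor_entry_mat_1:
  "length u = length w \<Longrightarrow> tensor_entry (mat 1) u w = of_bool (u = w)"
  by (induction u w rule: list_induct2) (simp_all add: mat_def)

lemma tensor_entry_nth:
  "length u = length w \<Longrightarrow> tensor_entry X u w = (\<Prod>i<length u. X $ (u ! i) $ (w ! i))"
  by (induction u w rule: list_induct2) (simp_all add: prod.lessThan_Suc_shift del: prod.lessThan_Suc)

text \<open>Tensor powers are multiplicative. This and the analogous facts for \<open>sym_entry\<close> below are
  the only way in which sums over the words on an edge are evaluated.\<close>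

lemma tensor_entry_mult:
  assumes "length u = length w"
  shows "(\<Sum>v\<in>words (length u). tensor_entry X u v * tensor_entry Y v w) = tensor_entry (X ** Y) u w"
  using assms
proof (induction u w rule: list_induct2)
  case Nil
  then show ?case by (simp add: words_0)
next
  case (Cons i u j w)
  have "(\<Sum>v\<in>words (length (i # u)). tensor_entry X (i # u) v * tensor_entry Y v (j # w)) =
    (\<Sum>k\<in>UNIV. X $ i $ k * Y $ k $ j * (\<Sum>v\<in>words (length u). tensor_entry X u v * tensor_entry Y v w))"
    by (simp add: sum_words_Suc sum_distrib_left mult_ac)
  also have "\<dots> = (X ** Y) $ i $ j * tensor_entry (X ** Y) u w"
    by (simp only: Cons.IH sum_distrib_right[symmetric]) (simp add: matrix_matrix_mult_def)
  finally show ?case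
    by simp
qed

lemma tensor_entry_permute:
  assumes "p permutes {..<length u}" "length u = length w"
  shows "tensor_entry X (permute_list p u) (permute_list p w) = tensor_entry X u w"
proof -
  have "tensor_entry X (permute_list p u) (permute_list p w) =
      (\<Prod>i<length u. X $ (u ! p i) $ (w ! p i))"
    using assms by (simp add: tensor_entry_nth permute_list_nth)
  also have "\<dots> = (\<Prod>i<length u. X $ (u ! i) $ (w ! i))"
    by (rule prod.permute[OF assms(1), unfolded comp_def, symmetric])
  finally show ?thesis
    using assms by (simp add: tensor_entry_nth)
qed

text \<open>The entries of the tensor power of \<open>X\<close> composed with the symmetrizer; for \<open>X = mat 1\<close>
  these are the entries of the symmetrizer itself.\<close>

definition sym_entry :: "complex ^ 2 ^ 2 \<Rightarrow> 2 list \<Rightarrow> 2 list \<Rightarrow> complex" where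
  "sym_entry X u w =
     1 / fact (length u) * (\<Sum>p | p permutes {..<length u}. tensor_entry X u (permute_list p w))"

lemma sym_entry_mult_left:
  assumes "length u = length w"
  shows "(\<Sum>v\<in>words (length u). tensor_entry X u v * sym_entry Y v w) = sym_entry (X ** Y) u w"
proof -
  have "(\<Sum>v\<in>words (length u). tensor_entry X u v * sym_entry Y v w) =
    1 / fact (length u) * (\<Sum>v\<in>words (length u). \<Sum>p | p permutes {..<length u}.
        tensor_entry X u v * tensor_entry Y v (permute_list p w))"
    by (simp add: sym_entry_def sum_distrib_left mult_ac)
  also have "\<dots> = 1 / fact (length u) * (\<Sum>p | p permutes {..<length u}.
      \<Sum>v\<in>words (length u). tensor_entry X u v * tensor_entry Y v (permute_list p w))"
    by (subst sum.swap) simp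
  also have "\<dots> = sym_entry (X ** Y) u w"
  proof -
    have "(\<Sum>v\<in>words (length u). tensor_entry X u v * tensor_entry Y v (permute_list p w)) =
        tensor_entry (X ** Y) u (permute_list p w)" for p
      by (rule tensor_entry_mult) (simp add: assms)
    then show ?thesis
      by (simp only: sym_entry_def)
  qed
  finally show ?thesis .
qed

text \<open>Permuting the letters of \<open>w\<close> amounts to the inverse permutation of the letters of \<open>u\<close>, and the
  sum over all permutations does not change when each of them is replaced by its inverse.\<close>

lemma sym_entry_transpose:
  assumes "length u = length w"
  shows "sym_entry (transpose X) u w = sym_entry X w u"
proof -
  have "tensor_entry (transpose X) u (permute_list p w) = tensor_entry X w (permute_list (inv p) u)"
    if p: "p permutes {..<length u}" for p
  proof -
    have "permute_list (inv p) (permute_list p w) = w"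
      using permute_list_compose[of "inv p" w p] permutes_inv[OF p] permutes_inv_o(1)[OF p] assms by simp
    then show ?thesis
      using tensor_entry_permute[OF permutes_inv[OF p], of "permute_list p w" X] assms
      by (simp add: tensor_entry_transpose) (metis assms length_permute_list permutes_inv[OF p] tensor_entry_permute)
  qed
  then show ?thesis
    using assms unfolding sym_entry_def
    by (simp add: sum_permutations_inverse[of "\<lambda>p. tensor_entry X w (permute_list p u)"])
qed

lemma sym_entry_mult_right:
  assumes "length u = length w"
  shows "(\<Sum>v\<in>words (length u). sym_entry X u v * tensor_entry Y v w) = sym_entry (X ** Y) u w"
proof -
  have "(\<Sum>v\<in>words (length u). sym_entry X u v * tensor_entry Y v w) =
      (\<Sum>v\<in>words (length w). tensor_entry (transpose Y) w v * sym_entry (transpose X) v u)"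
    using assms by (intro sum.cong) (simp_all add: tensor_entry_transpose sym_entry_transpose mult.commute)
  also have "\<dots> = sym_entry (transpose (X ** Y)) w u"
    using assms by (simp only: sym_entry_mult_left matrix_transpose_mul)
  also have "\<dots> = sym_entry (X ** Y) u w"
    using assms by (simp add: sym_entry_transpose)
  finally show ?thesis .
qed

lemma sym_entry_permute_right:
  assumes "q permutes {..<length w}" "length u = length w"
  shows "sym_entry X u (permute_list q w) = sym_entry X u w"
proof -
  have "(\<Sum>p | p permutes {..<length u}. tensor_entry X u (permute_list p (permute_list q w))) =
      (\<Sum>p | p permutes {..<length u}. tensor_entry X u (permute_list (q \<circ> p) w))"
    using assms by (intro sum.cong) (simp_all add: permute_list_compose)
  also have "\<dots> = (\<Sum>p | p permutes {..<length u}. tensor_entry X u (permute_list p w))"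
    using assms by (intro setum_permutations_compose_left[symmetric]) simp
  finally show ?thesis
    by (simp add: sym_entry_def)
qed

text \<open>Reversal is a permutation of the positions, so the symmetrizer absorbs it on both sides.\<close>

lemma sym_entry_rev:
  assumes "length u = length w"
  shows "sym_entry X (rev u) (rev w) = sym_entry X u w"
proof -
  define q where "q = (\<lambda>i. if i < length w then length w - Suc i else i)"
  have q: "q permutes {..<length w}"
    unfolding q_def by (rule bij_imp_permutes[OF bij_betw_byWitness[where f' = q]]) (auto simp: q_def)
  have rev: "rev x = permute_list q x" if "length x = length w" for x :: "2 list"
    using that by (intro nth_equalityI) (auto simp: rev_nth permute_list_def q_def)
  have "sym_entry X (rev u) (rev w) = sym_entry X (permute_list q u) (permute_list q w)"
    using assms by (simp add: rev)
  also have "\<dots> = sym_entry X (permute_list q u) w"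
    using assms q by (simp add: sym_entry_permute_right)
  also have "\<dots> = sym_entry (transpose X) w (permute_list q u)"
    using assms by (simp add: sym_entry_transpose)
  also have "\<dots> = sym_entry (transpose X) w u"
    using assms q by (simp add: sym_entry_permute_right)
  also have "\<dots> = sym_entry X u w"
    using assms by (simp add: sym_entry_transpose)
  finally show ?thesis .
qed

section \<open>Coordinates of the diagram maps\<close>

lemma sum_words_delta:
  fixes f :: "2 list \<Rightarrow> complex"
  assumes "length u = n"
  shows "(\<Sum>w\<in>words n. f w * of_bool (u = w)) = f u"
proof -
  have "(\<Sum>w\<in>words n. f w * of_bool (u = w)) = (\<Sum>w\<in>{u}. f w * of_bool (u = w))"
    using assms by (intro sum.mono_neutral_right) auto
  then show ?thesis
    by simp
qed

lemma fun_sum_apply: "(\<Sum>i\<in>A. f i) x = (\<Sum>i\<in>A. f i x)"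
  by (induction A rule: infinite_finite_induct) simp_all

abbreviation word_tensor :: "2 list \<Rightarrow> tensor" where
  "word_tensor w \<equiv> pure_tensor (map basis_vec w)"

lemma word_tensor_apply: "word_tensor w u = of_bool (u = w)"
proof (cases "length u = length w")
  case True
  have "word_tensor w u = tensor_entry (mat 1) u w"
    using True by (auto simp: pure_tensor_def tensor_entry_nth basis_vec_def mat_def axis_def intro!: prod.cong)
  then show ?thesis
    using True by (simp add: tensor_entry_mat_1)
qed (auto simp: pure_tensor_def)

lemma word_tensor_in_tensor_power: "word_tensor w \<in> tensor_power (length w)"
  by (simp add: tensor_power_def word_tensor_apply)

lemma tensor_eq_sum_words:
  assumes "t \<in> tensor_power n"
  shows "t = (\<Sum>w\<in>words n. tscale (t w) (word_tensor w))"
proof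
  fix u
  have "t u = (\<Sum>w\<in>words n. t w * of_bool (u = w))"
  proof (cases "length u = n")
    case True
    then show ?thesis by (rule sum_words_delta[symmetric])
  next
    case False
    then have "t u = 0"
      using assms by (auto simp: tensor_power_def)
    moreover have "(\<Sum>w\<in>words n. t w * of_bool (u = w)) = 0"
      using False by (intro sum.neutral) auto
    ultimately show ?thesis by simp
  qed
  then show "t u = (\<Sum>w\<in>words n. tscale (t w) (word_tensor w)) u"
    by (simp only: fun_sum_apply tscale_def word_tensor_apply)
qed

lemma multilinear_ext_apply:
  "multilinear_ext n F t u = (\<Sum>w\<in>words n. t w * F (map basis_vec w) u)"
  by (simp add: multilinear_ext_def fun_sum_apply tscale_def)

lemma linear_multilinear_ext: "Vector_Spaces.linear tscale tscale (multilinear_ext n F)"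
  unfolding linear_iff_module_hom
  by unfold_locales
    (simp_all add: fun_eq_iff multilinear_ext_apply tscale_def algebra_simps sum.distrib sum_distrib_left)

lemma multilinear_ext_in_tensor_power:
  assumes "\<And>w. length w = n \<Longrightarrow> F (map basis_vec w) \<in> tensor_power k"
  shows "multilinear_ext n F t \<in> tensor_power k"
proof -
  have "multilinear_ext n F t u = 0" if "length u \<noteq> k" for u
    unfolding multilinear_ext_apply
    using assms that by (intro sum.neutral) (auto simp: tensor_power_def)
  then show ?thesis
    by (auto simp: tensor_power_def)
qed

lemma tensor_mult_append:
  assumes "s \<in> tensor_power m" "length p = m"
  shows "tensor_mult s t (p @ q) = s p * t q"
proof -
  have "tensor_mult s t (p @ q) = (\<Sum>k\<in>{m}. s (take k (p @ q)) * t (drop k (p @ q)))"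
    unfolding tensor_mult_def using assms
    by (intro sum.mono_neutral_right) (auto simp: tensor_power_def)
  then show ?thesis
    using assms by simp
qed

lemma tensor_mult_in_tensor_power:
  assumes "s \<in> tensor_power m" "t \<in> tensor_power n"
  shows "tensor_mult s t \<in> tensor_power (m + n)"
proof -
  have "length w = m + n" if "tensor_mult s t w \<noteq> 0" for w
  proof -
    have "(\<Sum>k\<le>length w. s (take k w) * t (drop k w)) \<noteq> 0"
      using that by (simp add: tensor_mult_def)
    then obtain k where "k \<le> length w" "s (take k w) \<noteq> 0" "t (drop k w) \<noteq> 0"
      by (rule sum.not_neutral_contains_not_neutral) auto
    then have "length (take k w) = m" "length (drop k w) = n"
      using assms by (auto simp: tensor_power_def)
    then show ?thesis
      using length_append[of "take k w" "drop k w"] by simp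
  qed
  then show ?thesis
    by (simp add: tensor_power_def)
qed

lemma tensor_map_append:
  assumes "\<And>s. length s = m \<Longrightarrow> f (word_tensor s) \<in> tensor_power (length p)"
  shows "tensor_map m n f g t (p @ q) =
    (\<Sum>s\<in>words m. \<Sum>r\<in>words n. t (s @ r) * f (word_tensor s) p * g (word_tensor r) q)"
proof -
  have "tensor_mult (f (word_tensor s)) (g (word_tensor r)) (p @ q) =
      f (word_tensor s) p * g (word_tensor r) q" if "length s = m" for s r
    using assms that by (simp add: tensor_mult_append[where m = "length p"])
  then show ?thesis
    by (simp add: tensor_map_def multilinear_ext_apply sum_words_append take_map drop_map mult.assoc)
qed

lemma tensor_map_in_tensor_power:
  assumes "\<And>s. length s = m \<Longrightarrow> f (word_tensor s) \<in> tensor_power m'"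
    and "\<And>r. length r = n \<Longrightarrow> g (word_tensor r) \<in> tensor_power n'"
  shows "tensor_map m n f g t \<in> tensor_power (m' + n')"
  unfolding tensor_map_def
  by (intro multilinear_ext_in_tensor_power tensor_mult_in_tensor_power)
    (simp_all add: assms take_map drop_map)

lemma id_word_tensor_in_tensor_power: "length w = n \<Longrightarrow> id (word_tensor w) \<in> tensor_power n"
  using word_tensor_in_tensor_power by auto

text \<open>A middle map acts on the middle letters only: in a word split as \<open>p @ q @ r\<close> the outer pieces
  \<open>p\<close> and \<open>r\<close> are merely transported.\<close>

lemma tensor_map_mid_append:
  assumes "length p = l" "length r = n"
    and f: "\<And>s. length s = m \<Longrightarrow> f (word_tensor s) \<in> tensor_power (length q)"
  shows "tensor_map_mid l m n f t (p @ q @ r) =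
    (\<Sum>s\<in>words m. t (p @ s @ r) * f (word_tensor s) q)"
proof -
  have inner: "tensor_map m n f id t' (q @ r) = (\<Sum>s\<in>words m. t' (s @ r) * f (word_tensor s) q)" for t'
    using assms by (simp add: tensor_map_append word_tensor_apply sum_words_delta)
  have "tensor_map_mid l m n f t (p @ q @ r) = (\<Sum>s\<in>words l. (\<Sum>s'\<in>words (m + n).
      t (s @ s') * tensor_map m n f id (word_tensor s') (q @ r)) * of_bool (p = s))"
    unfolding tensor_map_mid_def
    by (subst tensor_map_append)
      (simp_all add: id_word_tensor_in_tensor_power[unfolded id_apply] assms(1) word_tensor_apply
        sum_distrib_right sum_distrib_left mult_ac)
  also have "\<dots> = (\<Sum>s'\<in>words (m + n). t (p @ s') * tensor_map m n f id (word_tensor s') (q @ r))"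
    using assms(1) by (rule sum_words_delta)
  also have "\<dots> = (\<Sum>x\<in>words m. \<Sum>s'\<in>words (m + n). t (p @ s') * f (word_tensor x) q * of_bool (x @ r = s'))"
    by (subst sum.swap)
      (simp add: inner word_tensor_apply sum_distrib_left mult_ac del: sum_of_bool_mult_eq sum_mult_of_bool_eq)
  also have "\<dots> = (\<Sum>s\<in>words m. t (p @ s @ r) * f (word_tensor s) q)"
    using assms(2) by (intro sum.cong refl sum_words_delta) simp
  finally show ?thesis .
qed

lemma tensor_map_mid_in_tensor_power:
  assumes "\<And>s. length s = m \<Longrightarrow> f (word_tensor s) \<in> tensor_power m'"
  shows "tensor_map_mid l m n f t \<in> tensor_power (l + m' + n)"
  unfolding tensor_map_mid_def add.assoc
  by (intro tensor_map_in_tensor_power id_word_tensor_in_tensor_power assms)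

lemma symmetrizer_apply:
  assumes "length u = n"
  shows "symmetrizer n t u = (\<Sum>w\<in>words n. t w * sym_entry (mat 1) u w)"
proof -
  have "pure_tensor (map (\<lambda>i. map basis_vec w ! p i) [0..<n]) u =
      tensor_entry (mat 1) u (permute_list p w)"
    if "length w = n" "p permutes {..<n}" for w p
  proof -
    have "map (\<lambda>i. map basis_vec w ! p i) [0..<n] = map basis_vec (permute_list p w)"
      using permutes_in_image[OF that(2)] that(1) by (auto simp: permute_list_def)
    then show ?thesis
      using assms that by (simp only: word_tensor_apply) (simp add: tensor_entry_mat_1)
  qed
  then show ?thesis
    using assms by (simp add: symmetrizer_def multilinear_ext_apply tscale_def fun_sum_apply sym_entry_def)
qed

lemma symmetrizer_in_tensor_power: "symmetrizer n t \<in> tensor_power n"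
  unfolding symmetrizer_def
  by (rule multilinear_ext_in_tensor_power)
    (auto simp: tensor_power_def tscale_def fun_sum_apply pure_tensor_def elim!: sum.not_neutral_contains_not_neutral split: if_splits)

lemma matrix_basis_vec_component: "(X *v basis_vec k) $ i = X $ i $ k"
  using exhaust_2[of k] by (auto simp: matrix_vector_mult_def sum_2 basis_vec_def axis_def)

lemma matrix_tensor_power_apply:
  assumes "length u = n"
  shows "matrix_tensor_power n X t u = (\<Sum>w\<in>words n. t w * tensor_entry X u w)"
proof -
  have "pure_tensor (map ((\<lambda>v. X *v v) \<circ> basis_vec) w) u = tensor_entry X u w" if "length w = n" for w
    using assms that by (simp add: pure_tensor_def tensor_entry_nth matrix_basis_vec_component)
  then show ?thesis
    by (simp add: matrix_tensor_power_def multilinear_ext_apply)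
qed

lemma matrix_tensor_power_in_tensor_power: "matrix_tensor_power n X t \<in> tensor_power n"
  unfolding matrix_tensor_power_def
  by (rule multilinear_ext_in_tensor_power) (auto simp: tensor_power_def pure_tensor_def)

text \<open>The skew form whose entries are the coordinates both of \<open>cup\<close> and of \<open>cap\<close>.\<close>

definition eps_matrix :: "complex ^ 2 ^ 2" where
  "eps_matrix = vector [vector [0, 1], vector [- 1, 0]]"

text \<open>The coordinates of nested cups and, equally, of nested caps: the last letter of \<open>s\<close> is paired
  with the first letter of \<open>t\<close>, and so on outwards. The reversal makes this an ordinary entry
  of a tensor power.\<close>

definition nest_entry :: "2 list \<Rightarrow> 2 list \<Rightarrow> complex" where
  "nest_entry s t = tensor_entry eps_matrix (rev s) t"

lemma eps_matrix_entries [simp]: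
  "eps_matrix $ 1 $ 1 = 0" "eps_matrix $ 1 $ 2 = 1"
  "eps_matrix $ 2 $ 1 = - 1" "eps_matrix $ 2 $ 2 = 0"
  by (simp_all add: eps_matrix_def)

lemma nest_entry_Nil [simp]: "nest_entry [] [] = 1"
  by (simp add: nest_entry_def)

lemma nest_entry_snoc_Cons:
  "nest_entry (s @ [i]) (j # t) = eps_matrix $ i $ j * nest_entry s t"
  by (simp add: nest_entry_def)

lemma cup_word_tensor: "cup (word_tensor []) [i, j] = eps_matrix $ i $ j"
  using exhaust_2[of i] exhaust_2[of j]
  by (auto simp: cup_def multilinear_ext_apply words_0 word_tensor_apply pure_tensor_def basis_vec_def axis_def)

lemma cup_in_tensor_power: "cup t \<in> tensor_power 2"
  unfolding cup_def
  by (rule multilinear_ext_in_tensor_power) (auto simp: tensor_power_def pure_tensor_def)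

lemma cap_word_tensor: "cap (word_tensor [i, j]) [] = eps_matrix $ i $ j"
proof -
  have "cap (word_tensor [i, j]) [] = (\<Sum>w\<in>{[i, j]}.
     det (transpose (vector [basis_vec (w ! 0), basis_vec (w ! 1)] :: complex ^ 2 ^ 2)))"
    unfolding cap_def multilinear_ext_apply
    by (rule sum.mono_neutral_cong_right)
      (auto simp: word_tensor_apply[of "[i, j]", simplified] tscale_def pure_tensor_def[of "[]"])
  also have "\<dots> = eps_matrix $ i $ j"
    using exhaust_2[of i] exhaust_2[of j]
    by (auto simp: det_2 transpose_def basis_vec_def axis_def)
  finally show ?thesis .
qed

lemma cap_in_tensor_power: "cap t \<in> tensor_power 0"
  unfolding cap_def
  by (rule multilinear_ext_in_tensor_power) (auto simp: tensor_power_def tscale_def pure_tensor_def)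

lemma nested_cup_in_tensor_power: "nested_cup n (word_tensor []) \<in> tensor_power (2 * n)"
proof (cases n)
  case 0
  then show ?thesis
    using word_tensor_in_tensor_power[of "[]"] by simp
next
  case (Suc k)
  have "nested_cup n (word_tensor []) \<in> tensor_power (k + 2 + k)"
    unfolding Suc nested_cup.simps comp_def
    by (rule tensor_map_mid_in_tensor_power) (rule cup_in_tensor_power)
  moreover have "k + 2 + k = 2 * n"
    using Suc by simp
  ultimately show ?thesis
    by (simp only:)
qed

lemma nested_cup_word_tensor:
  "length s = n \<Longrightarrow> length t = n \<Longrightarrow> nested_cup n (word_tensor []) (s @ t) = nest_entry s t"
proof (induction n arbitrary: s t)
  case 0
  then show ?case
    by (simp add: pure_tensor_def)
next
  case (Suc n)
  from Suc.prems obtain s' i where s: "s = s' @ [i]" "length s' = n"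
    by (metis length_Suc_conv_rev)
  from Suc.prems obtain j t' where t: "t = j # t'" "length t' = n"
    by (metis length_Suc_conv)
  have "nested_cup (Suc n) (word_tensor []) (s' @ [i, j] @ t') =
      (\<Sum>x\<in>words 0. nested_cup n (word_tensor []) (s' @ x @ t') * cup (word_tensor x) [i, j])"
    unfolding nested_cup.simps comp_def
    by (rule tensor_map_mid_append) (use s t cup_in_tensor_power in \<open>simp_all add: numeral_2_eq_2\<close>)
  also have "\<dots> = nest_entry s t"
    using Suc.IH[OF s(2) t(2)] by (simp add: s t words_0 cup_word_tensor[simplified] nest_entry_snoc_Cons)
  finally show ?case
    by (simp add: s t)
qed

lemma nested_cap_in_tensor_power: "t \<in> tensor_power (2 * n) \<Longrightarrow> nested_cap n t \<in> tensor_power 0"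
proof (induction n arbitrary: t)
  case (Suc n)
  have "tensor_map_mid n 2 n cap t \<in> tensor_power (n + 0 + n)"
    by (rule tensor_map_mid_in_tensor_power) (rule cap_in_tensor_power)
  then show ?case
    using Suc.IH by (simp add: mult_2)
qed simp

lemma nested_cap_apply:
  "nested_cap n t [] = (\<Sum>s\<in>words n. \<Sum>r\<in>words n. t (s @ r) * nest_entry s r)"
proof (induction n arbitrary: t)
  case 0
  then show ?case
    by (simp add: words_0)
next
  case (Suc n)
  have mid: "tensor_map_mid n 2 n cap t (s @ r) =
      (\<Sum>i\<in>UNIV. \<Sum>j\<in>UNIV. t (s @ [i, j] @ r) * eps_matrix $ i $ j)"
    if "length s = n" "length r = n" for s r
    using tensor_map_mid_append[of s n r n 2 cap "[]" t] that cap_in_tensor_power cap_word_tensor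
    by (simp add: numeral_2_eq_2 sum_words_Suc words_0)
  have "(\<Sum>s\<in>words (Suc n). \<Sum>r\<in>words (Suc n). t (s @ r) * nest_entry s r) =
      (\<Sum>s\<in>words n. \<Sum>i\<in>UNIV. \<Sum>j\<in>UNIV. \<Sum>r\<in>words n.
        t (s @ i # j # r) * nest_entry (s @ [i]) (j # r))"
    using sum_words_append[of "\<lambda>s. \<Sum>r\<in>words (Suc n). t (s @ r) * nest_entry s r" n "Suc 0"]
    by (simp add: sum_words_Suc words_0)
  also have "\<dots> = (\<Sum>s\<in>words n. \<Sum>r\<in>words n. \<Sum>i\<in>UNIV. \<Sum>j\<in>UNIV.
        t (s @ i # j # r) * nest_entry (s @ [i]) (j # r))"
    by (rule sum.cong[OF refl]) (rule trans[OF sum.cong[OF refl sum.swap] sum.swap])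
  also have "\<dots> = nested_cap (Suc n) t []"
    by (simp add: Suc.IH mid nest_entry_snoc_Cons sum_distrib_right mult.assoc)
  finally show ?case ..
qed

section \<open>The trace on the symmetric power\<close>

lemma subspace_tensor_power: "tensor.subspace (tensor_power n)"
proof -
  have "tensor_power n = {t. \<forall>w. length w \<noteq> n \<longrightarrow> t w = 0}"
    by (auto simp: tensor_power_def)
  then show ?thesis
    by (simp add: tensor.subspace_def tscale_def)
qed

text \<open>The trace of \<open>P \<circ> g\<close> on the image of \<open>P\<close> equals the trace of \<open>g \<circ> P\<close> on the full
  tensor power, where the words provide an explicit basis. In a basis \<open>B\<close> of the image both
  are the same double sum: the coefficients of \<open>P (g b)\<close> come from expanding \<open>g b\<close> in words,
  and the words composed with \<open>P\<close> are expanded back in \<open>B\<close>.\<close>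

lemma subspace_trace_range:
  fixes P g :: "tensor \<Rightarrow> tensor"
  assumes P: "Vector_Spaces.linear tscale tscale P" and g: "Vector_Spaces.linear tscale tscale g"
    and S: "S = P ` tensor_power n"
    and gS: "\<And>t. t \<in> S \<Longrightarrow> g t \<in> tensor_power n"
  shows "subspace_trace S (P \<circ> g) = (\<Sum>w\<in>words n. g (P (word_tensor w)) w)"
proof -
  interpret P: Vector_Spaces.linear tscale tscale P by (rule P)
  interpret g: Vector_Spaces.linear tscale tscale g by (rule g)
  have subspace: "tensor.subspace S"
    unfolding S by (rule P.subspace_image[OF subspace_tensor_power])
  define B where "B = (SOME B. tensor.independent B \<and> tensor.span B = S)"
  have "\<exists>B. tensor.independent B \<and> tensor.span B = S"
    using tensor.maximal_independent_subset[of S] subspace tensor.span_subspace by metis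
  then have B: "tensor.independent B" and span: "tensor.span B = S"
    unfolding B_def by (metis (mono_tags, lifting) someI_ex)+
  have expand: "P t = (\<Sum>w\<in>words n. tscale (t w) (P (word_tensor w)))" if "t \<in> tensor_power n" for t
    by (subst tensor_eq_sum_words[OF that]) (simp only: P.sum P.scale)
  have word: "P (word_tensor w) \<in> S" if "length w = n" for w
    unfolding S using word_tensor_in_tensor_power[of w] that by auto
  have "P t \<in> tensor.span ((\<lambda>w. P (word_tensor w)) ` words n)" if "t \<in> tensor_power n" for t
    unfolding expand[OF that] by (intro tensor.span_sum tensor.span_scale tensor.span_base imageI)
  then have "S \<subseteq> tensor.span ((\<lambda>w. P (word_tensor w)) ` words n)"
    unfolding S by blast
  \<comment> \<open>The sum over an infinite basis would be 0 by convention, so finiteness is essential.\<close>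
  then have "B \<subseteq> tensor.span ((\<lambda>w. P (word_tensor w)) ` words n)"
    using tensor.span_superset[of B] by (simp only: span)
  then have finite: "finite B"
    using tensor.independent_span_bound[OF finite_imageI[OF finite_words] B] by blast
  have "subspace_trace S (P \<circ> g) = (\<Sum>b\<in>B. tensor.representation B (P (g b)) b)"
    by (simp only: subspace_trace_def Let_def comp_def flip: B_def)
  also have "\<dots> = (\<Sum>b\<in>B. \<Sum>w\<in>words n. g b w * tensor.representation B (P (word_tensor w)) b)"
  proof (rule sum.cong[OF refl])
    fix b assume "b \<in> B"
    then have "g b \<in> tensor_power n"
      using gS span tensor.span_superset by blast
    then have "P (g b) = (\<Sum>w\<in>words n. tscale (g b w) (P (word_tensor w)))"
      by (rule expand)
    moreover have "tensor.representation B (\<Sum>w\<in>words n. tscale (g b w) (P (word_tensor w))) =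
        (\<lambda>b'. \<Sum>w\<in>words n. tensor.representation B (tscale (g b w) (P (word_tensor w))) b')"
      using word span by (intro tensor.representation_sum[OF B]) (auto intro: tensor.span_scale)
    moreover have "tensor.representation B (tscale (g b w) (P (word_tensor w))) b =
        g b w * tensor.representation B (P (word_tensor w)) b" if "length w = n" for w
      using word[OF that] span by (simp add: tensor.representation_scale[OF B])
    ultimately show "tensor.representation B (P (g b)) b =
        (\<Sum>w\<in>words n. g b w * tensor.representation B (P (word_tensor w)) b)"
      by simp
  qed
  also have "\<dots> = (\<Sum>w\<in>words n. \<Sum>b\<in>B. tensor.representation B (P (word_tensor w)) b * g b w)"
    by (subst sum.swap) (simp add: mult.commute)
  also have "\<dots> = (\<Sum>w\<in>words n. g (P (word_tensor w)) w)"
  proof (rule sum.cong[OF refl])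
    fix w assume "w \<in> words n"
    then have "(\<Sum>b\<in>B. tscale (tensor.representation B (P (word_tensor w)) b) b) = P (word_tensor w)"
      using tensor.sum_representation_eq[OF B _ finite, of "P (word_tensor w)"] word span by auto
    then have "g (P (word_tensor w)) =
        g (\<Sum>b\<in>B. tscale (tensor.representation B (P (word_tensor w)) b) b)"
      by (simp only:)
    also have "\<dots> = (\<Sum>b\<in>B. tscale (tensor.representation B (P (word_tensor w)) b) (g b))"
      by (simp only: g.sum g.scale)
    finally have "g (P (word_tensor w)) =
        (\<Sum>b\<in>B. tscale (tensor.representation B (P (word_tensor w)) b) (g b))" .
    then show "(\<Sum>b\<in>B. tensor.representation B (P (word_tensor w)) b * g b w) = g (P (word_tensor w)) w"
      by (simp add: fun_sum_apply tscale_def)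
  qed
  finally show ?thesis .
qed

section \<open>The theta sum\<close>

text \<open>The trivalent vertex with its legs bent so that all three point outwards. Read cyclically, the end
  of each word is joined to the beginning of the next one, by \<open>\<gamma>\<close>, \<open>\<alpha>\<close> and
  \<open>\<beta>\<close> nested cups; the degrees of the legs are \<open>\<beta> + \<gamma>\<close>,
  \<open>\<gamma> + \<alpha>\<close> and \<open>\<alpha> + \<beta>\<close>.\<close>

definition vertex :: "nat \<Rightarrow> nat \<Rightarrow> nat \<Rightarrow> 2 list \<Rightarrow> 2 list \<Rightarrow> 2 list \<Rightarrow> complex" where
  "vertex \<alpha> \<beta> \<gamma> u v w =
     nest_entry (drop \<beta> u) (take \<gamma> v) * nest_entry (drop \<gamma> v) (take \<alpha> w) *
     nest_entry (drop \<alpha> w) (take \<beta> u)"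

text \<open>The value of the theta diagram: two vertices whose legs are joined by symmetrized powers of
  \<open>X\<close>, \<open>Y\<close> and \<open>Z\<close>.\<close>

definition theta :: "nat \<Rightarrow> nat \<Rightarrow> nat \<Rightarrow> complex ^ 2 ^ 2 \<Rightarrow> complex ^ 2 ^ 2 \<Rightarrow> complex ^ 2 ^ 2 \<Rightarrow> complex"
  where
  "theta \<alpha> \<beta> \<gamma> X Y Z =
     (\<Sum>u\<in>words (\<beta> + \<gamma>). \<Sum>v\<in>words (\<gamma> + \<alpha>). \<Sum>w\<in>words (\<alpha> + \<beta>).
      \<Sum>u'\<in>words (\<beta> + \<gamma>). \<Sum>v'\<in>words (\<gamma> + \<alpha>). \<Sum>w'\<in>words (\<alpha> + \<beta>).
        vertex \<alpha> \<beta> \<gamma> u v w * vertex \<alpha> \<beta> \<gamma> u' v' w' *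
        sym_entry X u u' * sym_entry Y v v' * sym_entry Z w w')"

text \<open>The vertex is cyclic by construction, so only the order of summation changes.\<close>

lemma theta_cyclic: "theta \<beta> \<gamma> \<alpha> Y Z X = theta \<alpha> \<beta> \<gamma> X Y Z"
proof -
  have rot: "(\<Sum>v\<in>A. \<Sum>w\<in>B. \<Sum>u\<in>C. f u v w) = (\<Sum>u\<in>C. \<Sum>v\<in>A. \<Sum>w\<in>B. f u v w)"
    for A B C and f :: "2 list \<Rightarrow> 2 list \<Rightarrow> 2 list \<Rightarrow> complex"
    by (rule trans[OF sum.cong[OF refl sum.swap] sum.swap])
  have "theta \<beta> \<gamma> \<alpha> Y Z X =
     (\<Sum>v\<in>words (\<gamma> + \<alpha>). \<Sum>w\<in>words (\<alpha> + \<beta>). \<Sum>u\<in>words (\<beta> + \<gamma>).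
      \<Sum>v'\<in>words (\<gamma> + \<alpha>). \<Sum>w'\<in>words (\<alpha> + \<beta>). \<Sum>u'\<in>words (\<beta> + \<gamma>).
        vertex \<alpha> \<beta> \<gamma> u v w * vertex \<alpha> \<beta> \<gamma> u' v' w' *
        sym_entry X u u' * sym_entry Y v v' * sym_entry Z w w')"
    by (simp add: theta_def vertex_def mult_ac)
  also have "\<dots> = theta \<alpha> \<beta> \<gamma> X Y Z"
    unfolding theta_def by (rule trans[OF rot]) (intro sum.cong refl rot)
  finally show ?thesis .
qed

text \<open>Reflecting a nest of cups transposes each of them, and the form is skew.\<close>

lemma nest_entry_rev:
  assumes "length s = length t"
  shows "nest_entry (rev t) (rev s) = (- 1) ^ length s * nest_entry s t"
proof -
  have eps: "transpose eps_matrix = - eps_matrix"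
    by (simp add: vec_eq_iff forall_2 transpose_def)
  have "nest_entry (rev t) (rev s) = tensor_entry (transpose eps_matrix) (rev s) t"
    by (simp add: nest_entry_def tensor_entry_transpose)
  then show ?thesis
    using assms by (simp add: eps tensor_entry_uminus nest_entry_def)
qed

lemma vertex_rev:
  assumes "length u = \<beta> + \<gamma>" "length v = \<gamma> + \<alpha>" "length w = \<alpha> + \<beta>"
  shows "vertex \<beta> \<alpha> \<gamma> (rev v) (rev u) (rev w) = (- 1) ^ (\<alpha> + \<beta> + \<gamma>) * vertex \<alpha> \<beta> \<gamma> u v w"
proof -
  have "vertex \<beta> \<alpha> \<gamma> (rev v) (rev u) (rev w) =
      nest_entry (rev (take \<gamma> v)) (rev (drop \<beta> u)) * nest_entry (rev (take \<beta> u)) (rev (drop \<alpha> w)) *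
      nest_entry (rev (take \<alpha> w)) (rev (drop \<gamma> v))"
    using assms by (simp add: vertex_def rev_take rev_drop)
  then show ?thesis
    using assms by (simp add: nest_entry_rev power_add vertex_def)
qed

lemma sum_words_rev_swap:
  "(\<Sum>v\<in>words b. \<Sum>u\<in>words a. \<Sum>w\<in>words c. f (rev u) (rev v) (rev w)) =
   (\<Sum>u\<in>words a. \<Sum>v\<in>words b. \<Sum>w\<in>words c. f u v w)"
proof -
  have "(\<Sum>v\<in>words b. \<Sum>u\<in>words a. \<Sum>w\<in>words c. f (rev u) (rev v) (rev w)) =
      (\<Sum>v\<in>words b. \<Sum>u\<in>words a. \<Sum>w\<in>words c. f u v w)"
    by (simp only: sum_words_rev[of "f x y" for x y] sum_words_rev[of "\<lambda>u. \<Sum>w\<in>words c. f u y w" for y]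
        sum_words_rev[of "\<lambda>v. \<Sum>u\<in>words a. \<Sum>w\<in>words c. f u v w"])
  also have "\<dots> = (\<Sum>u\<in>words a. \<Sum>v\<in>words b. \<Sum>w\<in>words c. f u v w)"
    by (rule sum.swap)
  finally show ?thesis .
qed

text \<open>Reflection of the whole diagram, that is, reversal of all six words. Each vertex changes by the
  sign of \<open>vertex_rev\<close>, which therefore appears squared.\<close>

lemma theta_swap: "theta \<beta> \<alpha> \<gamma> Y X Z = theta \<alpha> \<beta> \<gamma> X Y Z"
proof -
  define G where "G = (\<lambda>u v w u' v' w'. vertex \<alpha> \<beta> \<gamma> u v w * vertex \<alpha> \<beta> \<gamma> u' v' w' *
    sym_entry X u u' * sym_entry Y v v' * sym_entry Z w w')"
  have sign: "(- 1) ^ k * x * ((- 1) ^ k * y) = x * y" for k and x y :: complex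
    by (cases "even k") simp_all
  have G: "vertex \<beta> \<alpha> \<gamma> v u w * vertex \<beta> \<alpha> \<gamma> v' u' w' *
        sym_entry Y v v' * sym_entry X u u' * sym_entry Z w w' =
      G (rev u) (rev v) (rev w) (rev u') (rev v') (rev w')"
    if "length u = \<beta> + \<gamma>" "length v = \<gamma> + \<alpha>" "length w = \<alpha> + \<beta>"
      "length u' = \<beta> + \<gamma>" "length v' = \<gamma> + \<alpha>" "length w' = \<alpha> + \<beta>" for u v w u' v' w'
    using that vertex_rev[of "rev u" \<beta> \<gamma> "rev v" \<alpha> "rev w"] vertex_rev[of "rev u'" \<beta> \<gamma> "rev v'" \<alpha> "rev w'"]
    by (simp add: G_def sign sym_entry_rev mult_ac(2))
  have "theta \<beta> \<alpha> \<gamma> Y X Z =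
     (\<Sum>v\<in>words (\<gamma> + \<alpha>). \<Sum>u\<in>words (\<beta> + \<gamma>). \<Sum>w\<in>words (\<alpha> + \<beta>).
      \<Sum>v'\<in>words (\<gamma> + \<alpha>). \<Sum>u'\<in>words (\<beta> + \<gamma>). \<Sum>w'\<in>words (\<alpha> + \<beta>).
        G (rev u) (rev v) (rev w) (rev u') (rev v') (rev w'))"
    unfolding theta_def by (intro sum.cong) (simp_all add: G add.commute)
  also have "\<dots> = theta \<alpha> \<beta> \<gamma> X Y Z"
    by (simp only: sum_words_rev_swap[of "G x y z" for x y z]
        sum_words_rev_swap[of "\<lambda>u v w. \<Sum>u'\<in>words (\<beta> + \<gamma>). \<Sum>v'\<in>words (\<gamma> + \<alpha>). \<Sum>w'\<in>words (\<alpha> + \<beta>). G u v w u' v' w'"])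
      (simp only: G_def theta_def)
  finally show ?thesis .
qed

text \<open>In dimension 2 a matrix scales the skew form by its determinant.\<close>

lemma eps_matrix_invariant: "transpose g ** eps_matrix ** g = (\<chi> i j. det g * eps_matrix $ i $ j)"
  by (simp add: vec_eq_iff forall_2 matrix_matrix_mult_def sum_2 transpose_def det_2 algebra_simps)

lemma nest_entry_invariant:
  assumes "det g = 1" "length s = n" "length t = n"
  shows "(\<Sum>x\<in>words n. \<Sum>y\<in>words n. nest_entry x y * tensor_entry g x s * tensor_entry g y t) = nest_entry s t"
proof -
  have "(\<Sum>x\<in>words n. \<Sum>y\<in>words n. nest_entry x y * tensor_entry g x s * tensor_entry g y t) =
      (\<Sum>x\<in>words n. tensor_entry g x s * (\<Sum>y\<in>words n. tensor_entry eps_matrix (rev x) y * tensor_entry g y t))"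
    by (simp add: nest_entry_def sum_distrib_left mult_ac)
  also have "\<dots> = (\<Sum>x\<in>words n. tensor_entry g x s * tensor_entry (eps_matrix ** g) (rev x) t)"
    using assms tensor_entry_mult[of "rev x" t for x] by (intro sum.cong) auto
  also have "\<dots> = (\<Sum>x\<in>words n. tensor_entry g (rev x) s * tensor_entry (eps_matrix ** g) x t)"
    by (subst sum_words_rev[symmetric]) simp
  also have "\<dots> = (\<Sum>x\<in>words n. tensor_entry (transpose g) (rev s) x * tensor_entry (eps_matrix ** g) x t)"
    using assms tensor_entry_rev[of _ s, symmetric] by (intro sum.cong) (auto simp: tensor_entry_transpose)
  also have "\<dots> = tensor_entry (transpose g ** (eps_matrix ** g)) (rev s) t"
    using assms tensor_entry_mult[of "rev s" t "transpose g"] by simp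
  finally show ?thesis
    using assms by (simp add: matrix_mul_assoc eps_matrix_invariant nest_entry_def)
qed

text \<open>Each word is cut at the point where its strands part. The sum then factors into one sum for
  each of the three nests, to which \<open>nest_entry_invariant\<close> applies.\<close>

lemma vertex_invariant:
  assumes "det g = 1" "length u' = \<beta> + \<gamma>" "length v' = \<gamma> + \<alpha>" "length w' = \<alpha> + \<beta>"
  shows "(\<Sum>u\<in>words (\<beta> + \<gamma>). \<Sum>v\<in>words (\<gamma> + \<alpha>). \<Sum>w\<in>words (\<alpha> + \<beta>).
      vertex \<alpha> \<beta> \<gamma> u v w * tensor_entry g u u' * tensor_entry g v v' * tensor_entry g w w') =
    vertex \<alpha> \<beta> \<gamma> u' v' w'"
proof -
  let ?E = "\<lambda>x y s t. nest_entry x y * tensor_entry g x s * tensor_entry g y t"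
  have split: "tensor_entry g (x @ y) z = tensor_entry g x (take m z) * tensor_entry g y (drop m z)"
    if "length x = m" "length z = m + k" for x y z m k
    using tensor_entry_append[of x "take m z" g y "drop m z"] that by simp
  have "(\<Sum>u\<in>words (\<beta> + \<gamma>). \<Sum>v\<in>words (\<gamma> + \<alpha>). \<Sum>w\<in>words (\<alpha> + \<beta>).
      vertex \<alpha> \<beta> \<gamma> u v w * tensor_entry g u u' * tensor_entry g v v' * tensor_entry g w w') =
    (\<Sum>p\<in>words \<beta>. \<Sum>s\<in>words \<gamma>. \<Sum>s'\<in>words \<gamma>. \<Sum>r\<in>words \<alpha>. \<Sum>r'\<in>words \<alpha>. \<Sum>p'\<in>words \<beta>.
       ?E s s' (drop \<beta> u') (take \<gamma> v') * (?E r r' (drop \<gamma> v') (take \<alpha> w') *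
       ?E p' p (drop \<alpha> w') (take \<beta> u')))"
    unfolding sum_words_append
    by (intro sum.cong refl) (use assms in \<open>simp add: vertex_def split mult_ac\<close>)
  also have "\<dots> = (\<Sum>p\<in>words \<beta>. \<Sum>s\<in>words \<gamma>. \<Sum>s'\<in>words \<gamma>. ?E s s' (drop \<beta> u') (take \<gamma> v') *
      (\<Sum>r\<in>words \<alpha>. \<Sum>r'\<in>words \<alpha>. ?E r r' (drop \<gamma> v') (take \<alpha> w') *
       (\<Sum>p'\<in>words \<beta>. ?E p' p (drop \<alpha> w') (take \<beta> u'))))"
    by (simp only: sum_distrib_left)
  also have "\<dots> = (\<Sum>p\<in>words \<beta>. (\<Sum>s\<in>words \<gamma>. \<Sum>s'\<in>words \<gamma>. ?E s s' (drop \<beta> u') (take \<gamma> v')) *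
      ((\<Sum>r\<in>words \<alpha>. \<Sum>r'\<in>words \<alpha>. ?E r r' (drop \<gamma> v') (take \<alpha> w')) *
       (\<Sum>p'\<in>words \<beta>. ?E p' p (drop \<alpha> w') (take \<beta> u'))))"
    by (simp only: sum_distrib_right)
  also have "\<dots> = nest_entry (drop \<beta> u') (take \<gamma> v') * (nest_entry (drop \<gamma> v') (take \<alpha> w') *
      (\<Sum>p\<in>words \<beta>. \<Sum>p'\<in>words \<beta>. ?E p' p (drop \<alpha> w') (take \<beta> u')))"
    using assms by (simp only: nest_entry_invariant length_drop length_take sum_distrib_left)
  also have "\<dots> = vertex \<alpha> \<beta> \<gamma> u' v' w'"
    using assms by (subst sum.swap) (simp add: nest_entry_invariant vertex_def)
  finally show ?thesis .
qed

lemma sum_rotate: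
  "(\<Sum>x\<in>A. \<Sum>y\<in>B. \<Sum>z\<in>C. f x y z) = (\<Sum>y\<in>B. \<Sum>z\<in>C. \<Sum>x\<in>A. f x y z)"
  by (rule trans[OF sum.swap sum.cong[OF refl sum.swap]])

lemma sum_triple_swap:
  fixes f :: "2 list \<Rightarrow> 2 list \<Rightarrow> 2 list \<Rightarrow> 2 list \<Rightarrow> 2 list \<Rightarrow> 2 list \<Rightarrow> complex"
  shows "(\<Sum>u\<in>A. \<Sum>v\<in>B. \<Sum>w\<in>C. \<Sum>u'\<in>A'. \<Sum>v'\<in>B'. \<Sum>w'\<in>C'. f u v w u' v' w') =
   (\<Sum>u'\<in>A'. \<Sum>v'\<in>B'. \<Sum>w'\<in>C'. \<Sum>u\<in>A. \<Sum>v\<in>B. \<Sum>w\<in>C. f u v w u' v' w')"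
proof -
  have out: "(\<Sum>u\<in>A. \<Sum>v\<in>B. \<Sum>w\<in>C. \<Sum>x\<in>D. g u v w x) = (\<Sum>x\<in>D. \<Sum>u\<in>A. \<Sum>v\<in>B. \<Sum>w\<in>C. g u v w x)"
    for D and g :: "2 list \<Rightarrow> 2 list \<Rightarrow> 2 list \<Rightarrow> 2 list \<Rightarrow> complex"
    by (rule trans[OF sum.cong[OF refl sum_rotate[symmetric]] sum.swap])
  show ?thesis
    by (rule trans[OF out sum.cong[OF refl trans[OF out sum.cong[OF refl out]]]])
qed

lemma vertex_transport:
  assumes "det g = 1"
  shows "(\<Sum>u\<in>words (\<beta> + \<gamma>). \<Sum>v\<in>words (\<gamma> + \<alpha>). \<Sum>w\<in>words (\<alpha> + \<beta>). vertex \<alpha> \<beta> \<gamma> u v w *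
      (\<Sum>u'\<in>words (\<beta> + \<gamma>). \<Sum>v'\<in>words (\<gamma> + \<alpha>). \<Sum>w'\<in>words (\<alpha> + \<beta>).
        tensor_entry g u u' * tensor_entry g v v' * tensor_entry g w w' * D u' v' w')) =
    (\<Sum>u\<in>words (\<beta> + \<gamma>). \<Sum>v\<in>words (\<gamma> + \<alpha>). \<Sum>w\<in>words (\<alpha> + \<beta>). vertex \<alpha> \<beta> \<gamma> u v w * D u v w)"
    (is "?L = ?R")
proof -
  have "?L = (\<Sum>u\<in>words (\<beta> + \<gamma>). \<Sum>v\<in>words (\<gamma> + \<alpha>). \<Sum>w\<in>words (\<alpha> + \<beta>).
      \<Sum>u'\<in>words (\<beta> + \<gamma>). \<Sum>v'\<in>words (\<gamma> + \<alpha>). \<Sum>w'\<in>words (\<alpha> + \<beta>).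
      vertex \<alpha> \<beta> \<gamma> u v w * tensor_entry g u u' * tensor_entry g v v' * tensor_entry g w w' * D u' v' w')"
    by (simp only: sum_distrib_left mult.assoc)
  also have "\<dots> = (\<Sum>u'\<in>words (\<beta> + \<gamma>). \<Sum>v'\<in>words (\<gamma> + \<alpha>). \<Sum>w'\<in>words (\<alpha> + \<beta>).
      (\<Sum>u\<in>words (\<beta> + \<gamma>). \<Sum>v\<in>words (\<gamma> + \<alpha>). \<Sum>w\<in>words (\<alpha> + \<beta>).
        vertex \<alpha> \<beta> \<gamma> u v w * tensor_entry g u u' * tensor_entry g v v' * tensor_entry g w w') * D u' v' w')"
    by (subst sum_triple_swap) (simp only: sum_distrib_right)
  also have "\<dots> = ?R"
    by (intro sum.cong refl) (simp add: vertex_invariant assms)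
  finally show ?thesis .
qed

text \<open>The factor \<open>g\<close> is split off each edge and moved along it into the first vertex, which absorbs
  it.\<close>

lemma theta_mult_left:
  assumes "det g = 1"
  shows "theta \<alpha> \<beta> \<gamma> (g ** X) (g ** Y) (g ** Z) = theta \<alpha> \<beta> \<gamma> X Y Z"
proof -
  let ?W = "\<lambda>F. \<Sum>u\<in>words (\<beta> + \<gamma>). \<Sum>v\<in>words (\<gamma> + \<alpha>). \<Sum>w\<in>words (\<alpha> + \<beta>). F u v w :: complex"
  let ?G = "\<lambda>u v w u' v' w'. tensor_entry g u u' * tensor_entry g v v' * tensor_entry g w w'"
  define D where "D X Y Z u v w = ?W (\<lambda>u' v' w'. vertex \<alpha> \<beta> \<gamma> u' v' w' *
      sym_entry X u u' * sym_entry Y v v' * sym_entry Z w w')" for X Y Z u v w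
  have theta: "theta \<alpha> \<beta> \<gamma> X Y Z = ?W (\<lambda>u v w. vertex \<alpha> \<beta> \<gamma> u v w * D X Y Z u v w)" for X Y Z
    unfolding theta_def D_def by (simp only: sum_distrib_left mult.assoc)
  have product: "x * (\<Sum>t\<in>A. f t) * (\<Sum>t\<in>B. f' t) * (\<Sum>t\<in>C. f'' t) =
      (\<Sum>t\<in>A. \<Sum>t'\<in>B. \<Sum>t''\<in>C. x * f t * f' t' * f'' t'')"
    for x :: complex and A B C :: "2 list set" and f f' f''
    by (simp only: sum_distrib_left[symmetric] sum_distrib_right[symmetric])
  have "D (g ** X) (g ** Y) (g ** Z) u v w = ?W (\<lambda>t t' t''. ?G u v w t t' t'' * D X Y Z t t' t'')"
    if l: "length u = \<beta> + \<gamma>" "length v = \<gamma> + \<alpha>" "length w = \<alpha> + \<beta>" for u v w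
  proof -
    have "D (g ** X) (g ** Y) (g ** Z) u v w = ?W (\<lambda>u' v' w'. vertex \<alpha> \<beta> \<gamma> u' v' w' *
        (\<Sum>t\<in>words (\<beta> + \<gamma>). tensor_entry g u t * sym_entry X t u') *
        (\<Sum>t\<in>words (\<gamma> + \<alpha>). tensor_entry g v t * sym_entry Y t v') *
        (\<Sum>t\<in>words (\<alpha> + \<beta>). tensor_entry g w t * sym_entry Z t w'))"
      unfolding D_def
    proof (intro sum.cong refl)
      fix u' v' w' :: "2 list"
      assume "u' \<in> words (\<beta> + \<gamma>)" "v' \<in> words (\<gamma> + \<alpha>)" "w' \<in> words (\<alpha> + \<beta>)"
      then show "vertex \<alpha> \<beta> \<gamma> u' v' w' * sym_entry (g ** X) u u' * sym_entry (g ** Y) v v' *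
          sym_entry (g ** Z) w w' = vertex \<alpha> \<beta> \<gamma> u' v' w' *
        (\<Sum>t\<in>words (\<beta> + \<gamma>). tensor_entry g u t * sym_entry X t u') *
        (\<Sum>t\<in>words (\<gamma> + \<alpha>). tensor_entry g v t * sym_entry Y t v') *
        (\<Sum>t\<in>words (\<alpha> + \<beta>). tensor_entry g w t * sym_entry Z t w')"
        using sym_entry_mult_left[of u u' g X] sym_entry_mult_left[of v v' g Y]
          sym_entry_mult_left[of w w' g Z] l by simp
    qed
    also have "\<dots> = ?W (\<lambda>u' v' w'. ?W (\<lambda>t t' t''. ?G u v w t t' t'' *
        (vertex \<alpha> \<beta> \<gamma> u' v' w' * sym_entry X t u' * sym_entry Y t' v' * sym_entry Z t'' w')))"
      unfolding product by (intro sum.cong refl) (simp only: mult_ac)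
    also have "\<dots> = ?W (\<lambda>t t' t''. ?W (\<lambda>u' v' w'. ?G u v w t t' t'' *
        (vertex \<alpha> \<beta> \<gamma> u' v' w' * sym_entry X t u' * sym_entry Y t' v' * sym_entry Z t'' w')))"
      by (rule sum_triple_swap)
    finally show ?thesis
      unfolding D_def by (simp only: sum_distrib_left)
  qed
  then have "theta \<alpha> \<beta> \<gamma> (g ** X) (g ** Y) (g ** Z) =
      ?W (\<lambda>u v w. vertex \<alpha> \<beta> \<gamma> u v w * ?W (\<lambda>t t' t''. ?G u v w t t' t'' * D X Y Z t t' t''))"
    unfolding theta by (intro sum.cong refl) simp
  also have "\<dots> = theta \<alpha> \<beta> \<gamma> X Y Z"
    unfolding theta by (rule vertex_transport[OF assms])
  finally show ?thesis .
qed

section \<open>Central functions as theta sums\<close>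

lemma nest_entry_swap:
  assumes "length s = length t"
  shows "nest_entry s t = (- 1) ^ length s * nest_entry t s"
  using nest_entry_rev[OF assms[symmetric]] assms
  by (simp add: nest_entry_def) (metis assms length_rev rev_rev_ident tensor_entry_rev)

text \<open>The third leg can be straightened: the two nests that end in \<open>w\<close> form one nest between
  \<open>w\<close> and the outer strands of \<open>u\<close> and \<open>v\<close>. The sign comes from turning around the cups
  between \<open>v\<close> and \<open>w\<close>.\<close>

lemma vertex_eq_nest_entry:
  assumes "length u = \<beta> + \<gamma>" "length v = \<gamma> + \<alpha>" "length w = \<alpha> + \<beta>"
  shows "vertex \<alpha> \<beta> \<gamma> u v w = (- 1) ^ \<alpha> *
    (nest_entry (drop \<beta> u) (take \<gamma> v) * nest_entry w (take \<beta> u @ drop \<gamma> v))"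
proof -
  have "nest_entry w (take \<beta> u @ drop \<gamma> v) =
      tensor_entry eps_matrix (rev (drop \<alpha> w) @ rev (take \<alpha> w)) (take \<beta> u @ drop \<gamma> v)"
    unfolding nest_entry_def by (simp flip: rev_append)
  also have "\<dots> = nest_entry (drop \<alpha> w) (take \<beta> u) * nest_entry (take \<alpha> w) (drop \<gamma> v)"
    using assms by (simp add: tensor_entry_append nest_entry_def)
  also have "nest_entry (take \<alpha> w) (drop \<gamma> v) = (- 1) ^ \<alpha> * nest_entry (drop \<gamma> v) (take \<alpha> w)"
    using assms by (subst nest_entry_swap) simp_all
  finally show ?thesis
    by (simp add: vertex_def flip: power_add mult_2)
qed

text \<open>Bending both ends of an edge replaces the matrix on it by its conjugate under the form, which
  for the identity is the identity again.\<close>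

lemma sum_nest_entry_sym_entry:
  assumes "length q = n" "length q' = n"
  shows "(\<Sum>w\<in>words n. \<Sum>w'\<in>words n. nest_entry w q * nest_entry w' q' * sym_entry (mat 1) w w') =
    sym_entry (mat 1) q q'"
proof -
  have eps: "transpose eps_matrix ** eps_matrix = mat 1"
    by (simp add: vec_eq_iff forall_2 matrix_matrix_mult_def sum_2 transpose_def mat_def)
  have "(\<Sum>w\<in>words n. \<Sum>w'\<in>words n. nest_entry w q * nest_entry w' q' * sym_entry (mat 1) w w') =
      (\<Sum>w\<in>words n. \<Sum>w'\<in>words n. tensor_entry eps_matrix (rev w) q * tensor_entry eps_matrix (rev w') q' *
        sym_entry (mat 1) (rev w) (rev w'))"
    by (simp add: nest_entry_def sym_entry_rev)
  also have "\<dots> = (\<Sum>w\<in>words n. \<Sum>w'\<in>words n. tensor_entry eps_matrix w q * tensor_entry eps_matrix w' q' *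
        sym_entry (mat 1) w w')"
    by (rule trans[OF sum_words_rev[of "\<lambda>w. \<Sum>w'\<in>words n. tensor_entry eps_matrix w q *
          tensor_entry eps_matrix (rev w') q' * sym_entry (mat 1) w (rev w')"]])
      (intro sum.cong refl sum_words_rev[of "\<lambda>w'. tensor_entry eps_matrix x q *
          tensor_entry eps_matrix w' q' * sym_entry (mat 1) x w'" for x])
  also have "\<dots> = (\<Sum>w\<in>words n. tensor_entry (transpose eps_matrix) q w *
      (\<Sum>w'\<in>words n. sym_entry (mat 1) w w' * tensor_entry eps_matrix w' q'))"
    by (simp add: tensor_entry_transpose sum_distrib_left mult_ac)
  also have "\<dots> = (\<Sum>w\<in>words n. tensor_entry (transpose eps_matrix) q w * sym_entry eps_matrix w q')"
    using assms sym_entry_mult_right[of _ q' "mat 1" eps_matrix]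
    by (intro sum.cong) auto
  also have "\<dots> = sym_entry (mat 1) q q'"
    using assms sym_entry_mult_left[of q q' "transpose eps_matrix" eps_matrix] by (simp add: eps)
  finally show ?thesis .
qed

text \<open>If the third edge carries the identity, its two ends can be unbent. What remains is the symmetrizer
  between the outer strands of the other two edges, as in the diagram of the central function.\<close>

lemma theta_mat_1:
  "theta \<alpha> \<beta> \<gamma> X Y (mat 1) =
    (\<Sum>u\<in>words (\<beta> + \<gamma>). \<Sum>v\<in>words (\<gamma> + \<alpha>). \<Sum>u'\<in>words (\<beta> + \<gamma>). \<Sum>v'\<in>words (\<gamma> + \<alpha>).
      nest_entry (drop \<beta> u) (take \<gamma> v) * nest_entry (drop \<beta> u') (take \<gamma> v') *
      sym_entry X u u' * sym_entry Y v v' *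
      sym_entry (mat 1) (take \<beta> u @ drop \<gamma> v) (take \<beta> u' @ drop \<gamma> v'))"
proof -
  let ?N = "\<lambda>u v. nest_entry (drop \<beta> u) (take \<gamma> v)" and ?q = "\<lambda>u v. take \<beta> u @ drop \<gamma> v"
  have sign: "(- 1) ^ k * x * ((- 1) ^ k * y) = x * y" for k and x y :: complex
    by (cases "even k") simp_all
  have "theta \<alpha> \<beta> \<gamma> X Y (mat 1) =
    (\<Sum>u\<in>words (\<beta> + \<gamma>). \<Sum>v\<in>words (\<gamma> + \<alpha>). \<Sum>u'\<in>words (\<beta> + \<gamma>). \<Sum>v'\<in>words (\<gamma> + \<alpha>).
     \<Sum>w\<in>words (\<alpha> + \<beta>). \<Sum>w'\<in>words (\<alpha> + \<beta>).
        vertex \<alpha> \<beta> \<gamma> u v w * vertex \<alpha> \<beta> \<gamma> u' v' w' *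
        sym_entry X u u' * sym_entry Y v v' * sym_entry (mat 1) w w')"
    unfolding theta_def by (intro sum.cong refl sum_rotate)
  also have "\<dots> =
    (\<Sum>u\<in>words (\<beta> + \<gamma>). \<Sum>v\<in>words (\<gamma> + \<alpha>). \<Sum>u'\<in>words (\<beta> + \<gamma>). \<Sum>v'\<in>words (\<gamma> + \<alpha>).
      ?N u v * ?N u' v' * sym_entry X u u' * sym_entry Y v v' *
     (\<Sum>w\<in>words (\<alpha> + \<beta>). \<Sum>w'\<in>words (\<alpha> + \<beta>).
        nest_entry w (?q u v) * nest_entry w' (?q u' v') * sym_entry (mat 1) w w'))"
    \<comment> \<open>Both vertices contribute the same sign, so the product of the two is unaffected.\<close>
    unfolding sum_distrib_left
    by (intro sum.cong refl) (simp add: vertex_eq_nest_entry sign mult_ac(2,3))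
  also have "\<dots> =
    (\<Sum>u\<in>words (\<beta> + \<gamma>). \<Sum>v\<in>words (\<gamma> + \<alpha>). \<Sum>u'\<in>words (\<beta> + \<gamma>). \<Sum>v'\<in>words (\<gamma> + \<alpha>).
      ?N u v * ?N u' v' * sym_entry X u u' * sym_entry Y v v' * sym_entry (mat 1) (?q u v) (?q u' v'))"
    by (intro sum.cong refl) (simp add: sum_nest_entry_sym_entry)
  finally show ?thesis .
qed

lemma linear_tensor_map: "Vector_Spaces.linear tscale tscale (tensor_map m n f g)"
  unfolding tensor_map_def by (rule linear_multilinear_ext)

text \<open>The middle part of the central function: cups are inserted, and the powers of \<open>X\<close> and \<open>Y\<close>
  merge with the symmetrizers.\<close>

lemma matrix_inj_map_apply:
  assumes "length u = \<beta> + \<gamma>" "length v = \<gamma> + \<alpha>"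
  shows "tensor_map (\<beta> + \<gamma>) (\<gamma> + \<alpha>) (matrix_tensor_power (\<beta> + \<gamma>) X) (matrix_tensor_power (\<gamma> + \<alpha>) Y)
      (tensor_map (\<beta> + \<gamma>) (\<gamma> + \<alpha>) (symmetrizer (\<beta> + \<gamma>)) (symmetrizer (\<gamma> + \<alpha>))
        (tensor_map_mid \<beta> 0 \<alpha> (nested_cup \<gamma>) t)) (u @ v) =
    (\<Sum>u'\<in>words (\<beta> + \<gamma>). \<Sum>v'\<in>words (\<gamma> + \<alpha>). t (take \<beta> u' @ drop \<gamma> v') *
      nest_entry (drop \<beta> u') (take \<gamma> v') * sym_entry X u u' * sym_entry Y v v')"
proof -
  let ?A = "words (\<beta> + \<gamma>)" and ?B = "words (\<gamma> + \<alpha>)"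
  define t' where "t' = tensor_map_mid \<beta> 0 \<alpha> (nested_cup \<gamma>) t"
  have t': "t' (s @ r) = t (take \<beta> s @ drop \<gamma> r) * nest_entry (drop \<beta> s) (take \<gamma> r)"
    if "length s = \<beta> + \<gamma>" "length r = \<gamma> + \<alpha>" for s r
  proof -
    have "t' (take \<beta> s @ (drop \<beta> s @ take \<gamma> r) @ drop \<gamma> r) =
      (\<Sum>x\<in>words 0. t (take \<beta> s @ x @ drop \<gamma> r) * nested_cup \<gamma> (word_tensor x) (drop \<beta> s @ take \<gamma> r))"
      unfolding t'_def using that nested_cup_in_tensor_power[of \<gamma>]
      by (intro tensor_map_mid_append) (simp_all add: mult_2)
    moreover have split: "s @ r = take \<beta> s @ (drop \<beta> s @ take \<gamma> r) @ drop \<gamma> r"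
      by (metis append.assoc append_take_drop_id)
    ultimately show ?thesis
      unfolding split
      using that nested_cup_word_tensor[of "drop \<beta> s" \<gamma> "take \<gamma> r"] by (simp add: words_0)
  qed
  have word: "(\<Sum>x\<in>words n. word_tensor w x * f x) = f w" if "length w = n" for w n f
    using sum_words_delta[OF that, of f] by (simp only: word_tensor_apply mult.commute eq_commute)
  have sym: "tensor_map (\<beta> + \<gamma>) (\<gamma> + \<alpha>) (symmetrizer (\<beta> + \<gamma>)) (symmetrizer (\<gamma> + \<alpha>)) t' (p @ q) =
      (\<Sum>s\<in>?A. \<Sum>r\<in>?B. t' (s @ r) * sym_entry (mat 1) p s * sym_entry (mat 1) q r)"
    if "length p = \<beta> + \<gamma>" "length q = \<gamma> + \<alpha>" for p q
    using that by (subst tensor_map_append)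
      (simp_all add: symmetrizer_in_tensor_power symmetrizer_apply word)
  have "tensor_map (\<beta> + \<gamma>) (\<gamma> + \<alpha>) (matrix_tensor_power (\<beta> + \<gamma>) X) (matrix_tensor_power (\<gamma> + \<alpha>) Y)
      (tensor_map (\<beta> + \<gamma>) (\<gamma> + \<alpha>) (symmetrizer (\<beta> + \<gamma>)) (symmetrizer (\<gamma> + \<alpha>)) t') (u @ v) =
    (\<Sum>p\<in>?A. \<Sum>q\<in>?B. (\<Sum>s\<in>?A. \<Sum>r\<in>?B. t' (s @ r) * sym_entry (mat 1) p s * sym_entry (mat 1) q r) *
      tensor_entry X u p * tensor_entry Y v q)"
    using assms by (subst tensor_map_append)
      (simp_all add: matrix_tensor_power_in_tensor_power matrix_tensor_power_apply word sym)
  also have "\<dots> = (\<Sum>p\<in>?A. \<Sum>q\<in>?B. \<Sum>s\<in>?A. \<Sum>r\<in>?B. t' (s @ r) *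
      (tensor_entry X u p * sym_entry (mat 1) p s) * (tensor_entry Y v q * sym_entry (mat 1) q r))"
    unfolding sum_distrib_right by (intro sum.cong refl) (simp only: mult_ac)
  also have "\<dots> = (\<Sum>s\<in>?A. \<Sum>r\<in>?B. \<Sum>p\<in>?A. \<Sum>q\<in>?B. t' (s @ r) *
      (tensor_entry X u p * sym_entry (mat 1) p s) * (tensor_entry Y v q * sym_entry (mat 1) q r))"
    by (rule trans[OF sum.cong[OF refl sum_rotate] sum_rotate])
  also have "\<dots> = (\<Sum>s\<in>?A. \<Sum>r\<in>?B. t' (s @ r) *
      (\<Sum>p\<in>?A. tensor_entry X u p * sym_entry (mat 1) p s) * (\<Sum>q\<in>?B. tensor_entry Y v q * sym_entry (mat 1) q r))"
    by (simp only: sum_distrib_left[symmetric] sum_distrib_right[symmetric])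
  also have "\<dots> = (\<Sum>s\<in>?A. \<Sum>r\<in>?B. t' (s @ r) * sym_entry X u s * sym_entry Y v r)"
  proof (intro sum.cong refl)
    fix s r :: "2 list" assume "s \<in> ?A" "r \<in> ?B"
    then show "t' (s @ r) * (\<Sum>p\<in>?A. tensor_entry X u p * sym_entry (mat 1) p s) *
        (\<Sum>q\<in>?B. tensor_entry Y v q * sym_entry (mat 1) q r) = t' (s @ r) * sym_entry X u s * sym_entry Y v r"
      using sym_entry_mult_left[of u s X "mat 1"] sym_entry_mult_left[of v r Y "mat 1"] assms by simp
  qed
  finally show ?thesis
    by (simp add: t' flip: t'_def)
qed

text \<open>The counterpart for the caps: evaluating them sums over the pieces that they join.\<close>

lemma cap_mid_apply:
  assumes "length p = \<beta>" "length r = \<alpha>"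
  shows "tensor_map_mid \<beta> (2 * \<gamma>) \<alpha> (nested_cap \<gamma>) t (p @ r) =
    (\<Sum>s\<in>words \<gamma>. \<Sum>s'\<in>words \<gamma>. t ((p @ s) @ (s' @ r)) * nest_entry s s')"
proof -
  have cap: "nested_cap \<gamma> (word_tensor (s @ s')) [] = nest_entry s s'"
    if l: "length s = \<gamma>" "length s' = \<gamma>" for s s'
  proof -
    have "nested_cap \<gamma> (word_tensor (s @ s')) [] =
        (\<Sum>x\<in>words \<gamma>. \<Sum>y\<in>words \<gamma>. nest_entry x y * of_bool (s' = y) * of_bool (s = x))"
      unfolding nested_cap_apply using l
      by (intro sum.cong refl) (auto simp: word_tensor_apply simp del: map_append)
    also have "\<dots> = (\<Sum>x\<in>words \<gamma>. (\<Sum>y\<in>words \<gamma>. nest_entry x y * of_bool (s' = y)) * of_bool (s = x))"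
      by (simp only: sum_distrib_right)
    finally show ?thesis
      using l by (simp only: sum_words_delta)
  qed
  have "tensor_map_mid \<beta> (2 * \<gamma>) \<alpha> (nested_cap \<gamma>) t (p @ [] @ r) =
      (\<Sum>x\<in>words (2 * \<gamma>). t (p @ x @ r) * nested_cap \<gamma> (word_tensor x) [])"
    by (rule tensor_map_mid_append[OF assms])
      (metis list.size(3) nested_cap_in_tensor_power word_tensor_in_tensor_power)
  then show ?thesis
    unfolding mult_2 sum_words_append by (simp add: cap del: map_append)
qed

text \<open>Taking the trace closes the diagram, with the symmetrizer of degree \<open>c\<close> on the third edge. A
  strand of this edge runs on along the first or the second one, so the words \<open>u\<close> and \<open>v\<close>
  are assembled from the outer pieces \<open>p\<close>, \<open>r\<close> and the pieces \<open>s\<close>, \<open>s'\<close>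
  that are joined by caps.\<close>

lemma central_function_eq_theta:
  "central_function (\<beta> + \<gamma>) (\<gamma> + \<alpha>) (\<alpha> + \<beta>) x1 x2 = theta \<alpha> \<beta> \<gamma> x1 x2 (mat 1)"
proof -
  let ?a = "\<beta> + \<gamma>" and ?b = "\<gamma> + \<alpha>" and ?c = "\<alpha> + \<beta>"
  define X where "X = tensor_map ?a ?b (matrix_tensor_power ?a x1) (matrix_tensor_power ?b x2)"
  define I where "I = tensor_map ?a ?b (symmetrizer ?a) (symmetrizer ?b)"
  define cups where "cups = tensor_map_mid \<beta> 0 \<alpha> (nested_cup \<gamma>)"
  define caps where "caps = tensor_map_mid \<beta> (2 * \<gamma>) \<alpha> (nested_cap \<gamma>)"
  define g where "g = caps \<circ> X \<circ> I \<circ> cups"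
  have div: "(\<gamma> + \<alpha> + (\<alpha> + \<beta>) - (\<beta> + \<gamma>)) div 2 = \<alpha>" "(\<beta> + \<gamma> + (\<alpha> + \<beta>) - (\<gamma> + \<alpha>)) div 2 = \<beta>"
    "(\<beta> + \<gamma> + (\<gamma> + \<alpha>) - (\<alpha> + \<beta>)) div 2 = \<gamma>"
    by simp_all
  have central: "central_function ?a ?b ?c x1 x2 = subspace_trace (sym_power ?c) (symmetrizer ?c \<circ> g)"
    unfolding central_function_def proj_map_def inj_map_def div Let_def g_def X_def I_def cups_def caps_def
    by (simp only: comp_assoc)
  have linear: "Vector_Spaces.linear tscale tscale g"
    unfolding g_def X_def I_def cups_def caps_def tensor_map_mid_def
    by (rule Vector_Spaces.linear_compose[OF linear_tensor_map Vector_Spaces.linear_compose[OF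
          linear_tensor_map Vector_Spaces.linear_compose[OF linear_tensor_map linear_tensor_map]]])
  have caps_range: "caps t \<in> tensor_power (\<beta> + 0 + \<alpha>)" for t
    unfolding caps_def using nested_cap_in_tensor_power word_tensor_in_tensor_power
    by (intro tensor_map_mid_in_tensor_power) metis
  have word: "symmetrizer ?c (word_tensor w) x = sym_entry (mat 1) x w" if "length w = ?c" "length x = ?c" for w x
    using that sum_words_delta[OF that(1), of "sym_entry (mat 1) x"]
    by (simp only: symmetrizer_apply word_tensor_apply mult.commute eq_commute)
  have sym: "sym_entry (mat 1) w x = sym_entry (mat 1) x w" if "length w = length x" for w x
    using sym_entry_transpose[OF that, of "mat 1"] by (simp add: transpose_mat)
  define F where "F u v u' v' = nest_entry (drop \<beta> u) (take \<gamma> v) * nest_entry (drop \<beta> u') (take \<gamma> v') *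
      sym_entry x1 u u' * sym_entry x2 v v' *
      sym_entry (mat 1) (take \<beta> u @ drop \<gamma> v) (take \<beta> u' @ drop \<gamma> v')" for u v u' v'
  have "central_function ?a ?b ?c x1 x2 = (\<Sum>w\<in>words ?c. g (symmetrizer ?c (word_tensor w)) w)"
    unfolding central
  proof (rule subspace_trace_range[OF _ linear])
    show "Vector_Spaces.linear tscale tscale (symmetrizer ?c)"
      unfolding symmetrizer_def by (rule linear_multilinear_ext)
    show "sym_power ?c = symmetrizer ?c ` tensor_power ?c"
      by (rule sym_power_def)
    show "g t \<in> tensor_power ?c" for t
      using caps_range by (simp add: g_def add.commute)
  qed
  also have "\<dots> = (\<Sum>p\<in>words \<beta>. \<Sum>r\<in>words \<alpha>. g (symmetrizer ?c (word_tensor (p @ r))) (p @ r))"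
    by (simp only: add.commute[of \<alpha> \<beta>] sum_words_append)
  also have "\<dots> = (\<Sum>p\<in>words \<beta>. \<Sum>r\<in>words \<alpha>. \<Sum>s\<in>words \<gamma>. \<Sum>s'\<in>words \<gamma>.
      \<Sum>u'\<in>words ?a. \<Sum>v'\<in>words ?b. F (p @ s) (s' @ r) u' v')"
  proof (intro sum.cong refl)
    fix p r :: "2 list" assume "p \<in> words \<beta>" "r \<in> words \<alpha>"
    then have l: "length p = \<beta>" "length r = \<alpha>" by simp_all
    have "g (symmetrizer ?c (word_tensor (p @ r))) (p @ r) = (\<Sum>s\<in>words \<gamma>. \<Sum>s'\<in>words \<gamma>.
        X (I (cups (symmetrizer ?c (word_tensor (p @ r))))) ((p @ s) @ (s' @ r)) * nest_entry s s')"
      unfolding g_def comp_def caps_def by (rule cap_mid_apply[OF l])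
    also have "\<dots> = (\<Sum>s\<in>words \<gamma>. \<Sum>s'\<in>words \<gamma>. \<Sum>u'\<in>words ?a. \<Sum>v'\<in>words ?b. F (p @ s) (s' @ r) u' v')"
    proof (intro sum.cong refl)
      fix s s' :: "2 list" assume "s \<in> words \<gamma>" "s' \<in> words \<gamma>"
      then have l': "length s = \<gamma>" "length s' = \<gamma>" by simp_all
      have "X (I (cups (symmetrizer ?c (word_tensor (p @ r))))) ((p @ s) @ (s' @ r)) =
        (\<Sum>u'\<in>words ?a. \<Sum>v'\<in>words ?b. symmetrizer ?c (word_tensor (p @ r)) (take \<beta> u' @ drop \<gamma> v') *
          nest_entry (drop \<beta> u') (take \<gamma> v') * sym_entry x1 (p @ s) u' * sym_entry x2 (s' @ r) v')"
        unfolding X_def I_def cups_def using l l' by (intro matrix_inj_map_apply) simp_all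
      then show "X (I (cups (symmetrizer ?c (word_tensor (p @ r))))) ((p @ s) @ (s' @ r)) * nest_entry s s' =
          (\<Sum>u'\<in>words ?a. \<Sum>v'\<in>words ?b. F (p @ s) (s' @ r) u' v')"
        using l l' by (simp add: word sum_distrib_left F_def sym[of _ "p @ r"] mult_ac del: map_append)
    qed
    finally show "g (symmetrizer ?c (word_tensor (p @ r))) (p @ r) = \<dots>" .
  qed
  also have "\<dots> = (\<Sum>p\<in>words \<beta>. \<Sum>s\<in>words \<gamma>. \<Sum>s'\<in>words \<gamma>. \<Sum>r\<in>words \<alpha>.
      \<Sum>u'\<in>words ?a. \<Sum>v'\<in>words ?b. F (p @ s) (s' @ r) u' v')"
    by (intro sum.cong refl sum_rotate)
  also have "\<dots> = theta \<alpha> \<beta> \<gamma> x1 x2 (mat 1)"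
    unfolding theta_mat_1 F_def[symmetric] sum_words_append[of _ \<beta> \<gamma>] sum_words_append[of _ \<gamma> \<alpha>] ..
  finally show ?thesis .
qed

section \<open>Polynomial functions in three variables\<close>

definition monomial_eval :: "complex ^ 3 \<Rightarrow> (3 \<Rightarrow>\<^sub>0 nat) \<Rightarrow> complex" where
  "monomial_eval v m = (\<Prod>i\<in>UNIV. (v $ i) ^ Poly_Mapping.lookup m i)"

lemma eval_superset:
  assumes "finite A" "Poly_Mapping.keys p \<subseteq> A"
  shows "eval p v = (\<Sum>m\<in>A. Poly_Mapping.lookup p m * monomial_eval v m)"
  unfolding eval_def eval_in_def monomial_eval_def id_apply
  using assms by (intro sum.mono_neutral_left) (auto simp: in_keys_iff)

lemma eval_zero [simp]: "eval 0 v = 0"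
  by (simp add: eval_superset[of "{}"])

lemma eval_add: "eval (p + q) v = eval p v + eval q v"
proof -
  let ?A = "Poly_Mapping.keys p \<union> Poly_Mapping.keys q"
  have "Poly_Mapping.keys (p + q) \<subseteq> ?A"
    by (rule Poly_Mapping.keys_add)
  then show ?thesis
    by (simp add: eval_superset[of ?A] lookup_add algebra_simps sum.distrib)
qed

lemma eval_diff: "eval (p - q) v = eval p v - eval q v"
  using eval_add[of "p - q" q v] by simp

lemma eval_sum: "eval (\<Sum>i\<in>A. f i) v = (\<Sum>i\<in>A. eval (f i) v)"
  by (induction A rule: infinite_finite_induct) (simp_all add: eval_add)

lemma eval_single: "eval (Poly_Mapping.single m k) v = k * monomial_eval v m"
  by (simp add: eval_superset[of "{m}"])

lemma poly3_sum_single: "p = (\<Sum>m\<in>Poly_Mapping.keys p. Poly_Mapping.single m (Poly_Mapping.lookup p m))"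
  by (rule poly_mapping_eqI) (simp add: lookup_sum lookup_single when_def in_keys_iff)

lemma eval_mult: "eval (p * q) v = eval p v * eval q v" for p q :: poly3
proof -
  have monomial: "monomial_eval v (m + m') = monomial_eval v m * monomial_eval v m'" for m m'
    by (simp add: monomial_eval_def lookup_add power_add prod.distrib)
  have "p * q = (\<Sum>m\<in>Poly_Mapping.keys p. \<Sum>m'\<in>Poly_Mapping.keys q.
      Poly_Mapping.single (m + m') (Poly_Mapping.lookup p m * Poly_Mapping.lookup q m'))"
    by (subst poly3_sum_single[of p], subst poly3_sum_single[of q]) (simp add: sum_product mult_single)
  then have "eval (p * q) v = (\<Sum>m\<in>Poly_Mapping.keys p. \<Sum>m'\<in>Poly_Mapping.keys q.
      (Poly_Mapping.lookup p m * monomial_eval v m) * (Poly_Mapping.lookup q m' * monomial_eval v m'))"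
    by (simp add: eval_sum eval_single monomial mult_ac)
  then show ?thesis
    by (simp add: eval_superset[OF finite_keys subset_refl] sum_product)
qed

lemma eval_Const: "eval (Const k) v = k"
  by (simp add: Const_def eval_single monomial_eval_def)

lemma eval_power: "eval (p ^ n) v = eval p v ^ n"
  using eval_Const[of 1 v] by (induction n) (simp_all add: eval_mult Const_def)

lemma eval_prod: "eval (\<Prod>i\<in>A. f i) v = (\<Prod>i\<in>A. eval (f i) v)"
  using eval_Const[of 1 v] by (induction A rule: infinite_finite_induct) (simp_all add: eval_mult Const_def)

lemma eval_Var: "eval (Var i) v = v $ i"
proof -
  have "monomial_eval v (Poly_Mapping.single i 1) = (\<Prod>j\<in>UNIV. if j = i then v $ j else 1)"
    unfolding monomial_eval_def by (intro prod.cong) (auto simp: lookup_single when_def)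
  then show ?thesis
    by (simp add: Var_def eval_single)
qed

lemma eval_subst: "eval (subst p q) v = eval p (\<chi> i. eval (q $ i) v)"
  by (simp add: subst_def eval_in_def eval_sum eval_mult eval_Const eval_prod eval_power)
    (simp add: eval_def eval_in_def)

text \<open>Uniqueness of the expansion in base \<open>N\<close>, for three digits with the last one unbounded.\<close>

lemma base_expansion_inject:
  fixes N :: nat
  assumes "a < N" "b < N" "a' < N" "b' < N" "a + N * (b + N * c) = a' + N * (b' + N * c')"
  shows "a = a' \<and> b = b' \<and> c = c'"
proof -
  have inj: "x = x' \<and> y = y'" if "x + N * y = x' + N * y'" "x < N" "x' < N" for x x' y y' :: nat
  proof -
    have "(x + N * y) mod N = (x' + N * y') mod N" "(x + N * y) div N = (x' + N * y') div N"
      using that(1) by simp_all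
    then show ?thesis
      using that(2,3) by simp
  qed
  show ?thesis
    using inj[OF assms(5,1,3)] inj[of b c b' c'] assms(2,4) by blast
qed

text \<open>Kronecker substitution: along the curve \<open>(t, t\<^sup>N, t\<^sup>N\<^sup>*\<^sup>N)\<close> with \<open>N\<close> larger than all
  exponents, distinct monomials become distinct powers of \<open>t\<close>. So \<open>p\<close> restricts to a
  univariate polynomial with the same coefficients, which has every complex number as a root.\<close>

lemma eval_eq_0_imp_eq_0:
  assumes "\<And>v. eval p v = 0"
  shows "p = 0"
proof (rule ccontr)
  assume "p \<noteq> 0"
  let ?K = "Poly_Mapping.keys p"
  obtain m where m: "m \<in> ?K"
    using \<open>p \<noteq> 0\<close> keys_eq_empty[of p] by blast
  \<comment> \<open>Any bound on the exponents of the monomials of p will do; their total is the simplest.\<close>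
  define N where "N = Suc (\<Sum>m\<in>?K. \<Sum>i\<in>UNIV. Poly_Mapping.lookup m i)"
  have N: "Poly_Mapping.lookup m i < N" if "m \<in> ?K" for m i
  proof -
    have "Poly_Mapping.lookup m i \<le> (\<Sum>i\<in>UNIV. Poly_Mapping.lookup m i)"
      by (rule member_le_sum) simp_all
    also have "\<dots> \<le> (\<Sum>m\<in>?K. \<Sum>i\<in>UNIV. Poly_Mapping.lookup m i)"
      using that by (intro member_le_sum[of m ?K "\<lambda>m. \<Sum>i\<in>UNIV. Poly_Mapping.lookup m i"]) simp_all
    finally show ?thesis
      by (simp add: N_def)
  qed
  define e where "e m = Poly_Mapping.lookup m 1 + N * (Poly_Mapping.lookup m 2 + N * Poly_Mapping.lookup m (3 :: 3))"
    for m :: "3 \<Rightarrow>\<^sub>0 nat"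
  have inj: "inj_on e ?K"
  proof (rule inj_onI)
    fix m m' assume "m \<in> ?K" "m' \<in> ?K" "e m = e m'"
    then have "\<forall>i. Poly_Mapping.lookup m i = Poly_Mapping.lookup m' i"
      using base_expansion_inject[of "Poly_Mapping.lookup m 1" N "Poly_Mapping.lookup m 2"
          "Poly_Mapping.lookup m' 1" "Poly_Mapping.lookup m' 2"] N
      by (simp add: e_def forall_3)
    then show "m = m'"
      by (simp add: poly_mapping_eqI)
  qed
  define q :: "complex poly" where "q = (\<Sum>m\<in>?K. monom (Poly_Mapping.lookup p m) (e m))"
  have "poly q t = 0" for t
  proof -
    have "monomial_eval (vector [t, t ^ N, t ^ (N * N)]) m = t ^ e m" for m
    proof -
      have "monomial_eval (vector [t, t ^ N, t ^ (N * N)]) m = t ^ Poly_Mapping.lookup m 1 *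
          ((t ^ N) ^ Poly_Mapping.lookup m 2 * (t ^ (N * N)) ^ Poly_Mapping.lookup m 3)"
        unfolding monomial_eval_def UNIV_3 by simp
      also have "\<dots> = t ^ e m"
        unfolding e_def power_mult[symmetric] power_add[symmetric] by (simp add: distrib_left mult.assoc)
      finally show ?thesis .
    qed
    then have "poly q t = eval p (vector [t, t ^ N, t ^ (N * N)])"
      by (simp add: q_def poly_sum poly_monom eval_superset[OF finite_keys subset_refl])
    then show ?thesis
      using assms by simp
  qed
  then have "q = 0"
    using poly_all_0_iff_0 by blast
  moreover have "coeff q (e m) = (\<Sum>m'\<in>?K. if m' = m then Poly_Mapping.lookup p m' else 0)"
    unfolding q_def coeff_sum using inj m by (intro sum.cong) (auto dest: inj_onD)
  ultimately show False
    using m by (simp add: in_keys_iff)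
qed

lemma eval_inject: "(\<And>v. eval p v = eval q v) \<Longrightarrow> p = q"
  using eval_eq_0_imp_eq_0[of "p - q"] by (simp add: eval_diff)

section \<open>Traces in the special linear group\<close>

definition adjugate2 :: "complex ^ 2 ^ 2 \<Rightarrow> complex ^ 2 ^ 2" where
  "adjugate2 x = vector [vector [x $ 2 $ 2, - x $ 1 $ 2], vector [- x $ 2 $ 1, x $ 1 $ 1]]"

lemma adjugate2_mult:
  assumes "x \<in> SL2"
  shows "adjugate2 x ** x = mat 1" "x ** adjugate2 x = mat 1"
  using assms
  by (simp_all add: SL2_def det_2 adjugate2_def vec_eq_iff forall_2 matrix_matrix_mult_def sum_2 mat_def algebra_simps)

lemma matrix_inv_SL2:
  assumes "x \<in> SL2"
  shows "matrix_inv x = adjugate2 x"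
  unfolding matrix_inv_def
proof (rule some_equality)
  show "x ** adjugate2 x = mat 1 \<and> adjugate2 x ** x = mat 1"
    using adjugate2_mult[OF assms] by simp
  show "y = adjugate2 x" if "x ** y = mat 1 \<and> y ** x = mat 1" for y
    using that adjugate2_mult(2)[OF assms]
    by (metis matrix_mul_assoc matrix_mul_lid matrix_mul_rid)
qed

lemma adjugate2_in_SL2: "x \<in> SL2 \<Longrightarrow> adjugate2 x \<in> SL2"
  by (simp add: SL2_def det_2 adjugate2_def algebra_simps)

lemma adjugate2_adjugate2 [simp]: "adjugate2 (adjugate2 x) = x"
  by (simp add: adjugate2_def vec_eq_iff forall_2)

lemma adjugate2_matrix_mult: "adjugate2 (x ** y) = adjugate2 y ** adjugate2 x"
  by (simp add: adjugate2_def vec_eq_iff forall_2 matrix_matrix_mult_def sum_2 algebra_simps)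

lemma trace_adjugate2 [simp]: "trace (adjugate2 x) = trace x"
  by (simp add: adjugate2_def trace_def sum_2)

lemma SL2_mult: "x \<in> SL2 \<Longrightarrow> y \<in> SL2 \<Longrightarrow> x ** y \<in> SL2"
  by (simp add: SL2_def det_mul)

text \<open>The matrices are chosen such that the trace of the quotient is \<open>s + 1 / s\<close>, whatever \<open>x\<close> and
  \<open>y\<close> are; \<open>s\<close> is then a root of a quadratic equation with constant term 1.\<close>

lemma exists_SL2_traces:
  obtains x1 x2 where "x1 \<in> SL2" "x2 \<in> SL2" "trace x2 = y" "trace x1 = x" "trace (x1 ** matrix_inv x2) = z"
proof -
  define s where "s = (z + csqrt (z\<^sup>2 - 4)) / 2"
  have "4 * (s * s - z * s + 1) = (csqrt (z\<^sup>2 - 4))\<^sup>2 - (z\<^sup>2 - 4)"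
    by (simp add: s_def power2_eq_square field_simps)
  then have "4 * (s * s - z * s + 1) = 0"
    by (simp only: power2_csqrt diff_self)
  then have s: "s * s - z * s + 1 = 0"
    by (metis mult_eq_0_iff zero_neq_numeral)
  then have "s \<noteq> 0"
    by auto
  then have z: "s + 1 / s = z"
    using s by (simp add: field_simps)
  define x1 :: "complex ^ 2 ^ 2" where "x1 = vector [vector [x, - 1], vector [1, 0]]"
  define x2 :: "complex ^ 2 ^ 2" where "x2 = vector [vector [y, - s], vector [1 / s, 0]]"
  have SL2: "x1 \<in> SL2" "x2 \<in> SL2"
    using \<open>s \<noteq> 0\<close> by (simp_all add: x1_def x2_def SL2_def det_2)
  show ?thesis
  proof
    show "trace (x1 ** matrix_inv x2) = z"
      unfolding matrix_inv_SL2[OF SL2(2)]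
      by (simp add: x1_def x2_def adjugate2_def trace_def sum_2 matrix_matrix_mult_def add.commute flip: z)
  qed (use SL2 in \<open>simp_all add: x1_def x2_def trace_def sum_2\<close>)
qed

section \<open>Symmetry of the central functions and their polynomials\<close>

lemma admissibleE:
  assumes "admissible a b c"
  obtains \<alpha> \<beta> \<gamma> where "a = \<beta> + \<gamma>" "b = \<gamma> + \<alpha>" "c = \<alpha> + \<beta>"
proof -
  from assms obtain \<alpha> \<beta> \<gamma> :: nat where
    "(- real a + real b + real c) / 2 = real \<alpha>" "(real a - real b + real c) / 2 = real \<beta>"
    "(real a + real b - real c) / 2 = real \<gamma>"
    unfolding admissible_def by (metis Nats_cases)
  then have "real a = real (\<beta> + \<gamma>)" "real b = real (\<gamma> + \<alpha>)" "real c = real (\<alpha> + \<beta>)"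
    by (simp_all add: field_simps)
  then show ?thesis
    by (intro that) (simp_all only: of_nat_eq_iff)
qed

lemma admissibleI: "admissible (\<beta> + \<gamma>) (\<gamma> + \<alpha>) (\<alpha> + \<beta>)"
proof -
  have "(- real (\<beta> + \<gamma>) + real (\<gamma> + \<alpha>) + real (\<alpha> + \<beta>)) / 2 = real \<alpha>"
    "(real (\<beta> + \<gamma>) - real (\<gamma> + \<alpha>) + real (\<alpha> + \<beta>)) / 2 = real \<beta>"
    "(real (\<beta> + \<gamma>) + real (\<gamma> + \<alpha>) - real (\<alpha> + \<beta>)) / 2 = real \<gamma>"
    by simp_all
  then show ?thesis
    unfolding admissible_def by (simp only: of_nat_in_Nats)
qed

lemma admissible_swap: "admissible a b c \<Longrightarrow> admissible b a c"
  by (erule admissibleE) (metis add.commute admissibleI)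

lemma admissible_cyclic: "admissible a b c \<Longrightarrow> admissible b c a"
  by (erule admissibleE) (metis admissibleI)

lemma central_function_swap:
  assumes "admissible a b c"
  shows "central_function b a c y x = central_function a b c x y"
proof -
  from assms obtain \<alpha> \<beta> \<gamma> where abc: "a = \<beta> + \<gamma>" "b = \<gamma> + \<alpha>" "c = \<alpha> + \<beta>"
    by (rule admissibleE)
  have "central_function (\<alpha> + \<gamma>) (\<gamma> + \<beta>) (\<beta> + \<alpha>) y x = central_function (\<beta> + \<gamma>) (\<gamma> + \<alpha>) (\<alpha> + \<beta>) x y"
    unfolding central_function_eq_theta by (rule theta_swap)
  then show ?thesis
    by (simp only: abc add.commute)
qed

text \<open>Rotation moves the identity to the second edge. A common left factor, the inverse of
  \<open>x\<close>, turns the third edge, which carries \<open>x\<close>, into the identity.\<close>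

lemma central_function_cyclic:
  assumes "admissible a b c" "x \<in> SL2"
  shows "central_function b c a (adjugate2 x ** y) (adjugate2 x) = central_function a b c x y"
proof -
  from assms(1) obtain \<alpha> \<beta> \<gamma> where abc: "a = \<beta> + \<gamma>" "b = \<gamma> + \<alpha>" "c = \<alpha> + \<beta>"
    by (rule admissibleE)
  have "theta \<beta> \<gamma> \<alpha> (adjugate2 x ** y) (adjugate2 x) (mat 1) =
      theta \<beta> \<gamma> \<alpha> (adjugate2 x ** y) (adjugate2 x ** mat 1) (adjugate2 x ** x)"
    using assms(2) by (simp add: adjugate2_mult)
  also have "\<dots> = theta \<beta> \<gamma> \<alpha> y (mat 1) x"
    using adjugate2_in_SL2[OF assms(2)] by (intro theta_mult_left) (simp add: SL2_def)
  also have "\<dots> = theta \<alpha> \<beta> \<gamma> x y (mat 1)"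
    by (rule theta_cyclic)
  finally show ?thesis
    unfolding abc central_function_eq_theta .
qed

lemma represents_central_functionD:
  assumes "represents_central_function p (vector [a, b, c])" "x1 \<in> SL2" "x2 \<in> SL2"
  shows "eval p (vector [trace x2, trace x1, trace (x1 ** adjugate2 x2)]) = central_function a b c x1 x2"
  using assms by (simp add: represents_central_function_def matrix_inv_SL2)

lemma eval_swap:
  assumes "admissible a b c"
    and "represents_central_function p (vector [a, b, c])"
    and "represents_central_function q (vector [b, a, c])"
  shows "eval q (vector [x, y, z]) = eval p (vector [y, x, z])"
proof -
  obtain x1 x2 where SL2: "x1 \<in> SL2" "x2 \<in> SL2"
    and tr: "trace x2 = y" "trace x1 = x" "trace (x1 ** matrix_inv x2) = z"
    by (rule exists_SL2_traces)
  have "trace (x2 ** adjugate2 x1) = trace (adjugate2 (x2 ** adjugate2 x1))"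
    by simp
  also have "\<dots> = trace (x1 ** adjugate2 x2)"
    by (simp only: adjugate2_matrix_mult adjugate2_adjugate2)
  finally have "eval q (vector [x, y, z]) = central_function b a c x2 x1"
    using represents_central_functionD[OF assms(3) SL2(2,1)] tr SL2 by (simp add: matrix_inv_SL2)
  also have "\<dots> = eval p (vector [y, x, z])"
    using represents_central_functionD[OF assms(2) SL2] tr SL2
    by (simp add: matrix_inv_SL2 central_function_swap[OF assms(1)])
  finally show ?thesis .
qed

lemma eval_cyclic:
  assumes "admissible a b c"
    and "represents_central_function p (vector [a, b, c])"
    and "represents_central_function q (vector [b, c, a])"
  shows "eval q (vector [x, z, y]) = eval p (vector [y, x, z])"
proof -
  obtain x1 x2 where SL2: "x1 \<in> SL2" "x2 \<in> SL2"
    and tr: "trace x2 = y" "trace x1 = x" "trace (x1 ** matrix_inv x2) = z"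
    by (rule exists_SL2_traces)
  have inv: "adjugate2 x1 \<in> SL2" "adjugate2 x1 ** x2 \<in> SL2"
    using SL2 by (simp_all add: adjugate2_in_SL2 SL2_mult)
  have "trace (adjugate2 x1 ** x2) = trace (adjugate2 (adjugate2 x1 ** x2))"
    by simp
  also have "\<dots> = trace (adjugate2 x2 ** x1)"
    by (simp only: adjugate2_matrix_mult adjugate2_adjugate2)
  also have "\<dots> = z"
    using trace_mul_sym[of x1 "adjugate2 x2"] tr SL2 by (simp add: matrix_inv_SL2)
  finally have tr_z: "trace (adjugate2 x1 ** x2) = z" .
  have "trace (adjugate2 x1 ** x2 ** x1) = trace (x1 ** adjugate2 x1 ** x2)"
    by (simp only: trace_mul_sym[of "adjugate2 x1 ** x2"] matrix_mul_assoc)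
  then have tr_y: "trace (adjugate2 x1 ** x2 ** x1) = y"
    using tr SL2 by (simp add: adjugate2_mult)
  have "eval q (vector [x, z, y]) = central_function b c a (adjugate2 x1 ** x2) (adjugate2 x1)"
    using represents_central_functionD[OF assms(3) inv(2,1)] tr tr_z tr_y by simp
  also have "\<dots> = eval p (vector [y, x, z])"
    using represents_central_functionD[OF assms(2) SL2] tr SL2
    by (simp add: matrix_inv_SL2 central_function_cyclic[OF assms(1)])
  finally show ?thesis .
qed

lemma vector_3_eta: "vector [v $ 1, v $ 2, v $ 3] = (v :: 'a :: zero ^ 3)"
  by (simp add: vec_eq_iff forall_3)

text \<open>Together with its arguments, \<open>p\<close> is a symmetric function of the three pairs of a degree and a
  variable. The transposition and the cycle suffice, and stating the result with \<open>\<sigma>\<close> on both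
  sides avoids inverses.\<close>

lemma eval_permute:
  fixes p :: "nat ^ 3 \<Rightarrow> poly3"
  assumes rep: "\<And>d. admissible_triple d \<Longrightarrow> represents_central_function (p d) d"
    and "admissible_triple d" "bij \<sigma>"
  shows "eval (p (permute_triple \<sigma> d)) (permute_triple \<sigma> v) = eval (p d) v"
proof -
  define F where "F a b c y x z = eval (p (vector [a, b, c])) (vector [y, x, z])" for a b c y x z
  have rep': "represents_central_function (p (vector [a, b, c])) (vector [a, b, c])"
    if "admissible a b c" for a b c
    using rep[of "vector [a, b, c]"] that by (simp add: admissible_triple_def)
  have swap: "F b a c x y z = F a b c y x z" if "admissible a b c" for a b c y x z
    unfolding F_def by (rule eval_swap[OF that rep'[OF that] rep'[OF admissible_swap[OF that]]])
  have cyclic: "F b c a x z y = F a b c y x z" if "admissible a b c" for a b c y x z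
    unfolding F_def by (rule eval_cyclic[OF that rep'[OF that] rep'[OF admissible_cyclic[OF that]]])
  have perm: "permute_triple \<sigma> w = vector [w $ \<sigma> 1, w $ \<sigma> 2, w $ \<sigma> 3]" for w :: "'a :: zero ^ 3"
    by (simp add: permute_triple_def vec_eq_iff forall_3)
  have adm: "admissible (d $ 1) (d $ 2) (d $ 3)"
    using assms(2) by (simp add: admissible_triple_def)
  let ?G = "F (d $ 1) (d $ 2) (d $ 3) (v $ 1) (v $ 2) (v $ 3)"
  have adm': "admissible (d $ 2) (d $ 3) (d $ 1)" "admissible (d $ 3) (d $ 1) (d $ 2)"
    by (rule admissible_cyclic[OF adm], rule admissible_cyclic[OF admissible_cyclic[OF adm]])
  have c1: "F (d $ 2) (d $ 3) (d $ 1) (v $ 2) (v $ 3) (v $ 1) = ?G"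
    by (rule cyclic[OF adm])
  have c2: "F (d $ 3) (d $ 1) (d $ 2) (v $ 3) (v $ 1) (v $ 2) = ?G"
    by (rule trans[OF cyclic[OF adm'(1)] c1])
  have s: "F (d $ 2) (d $ 1) (d $ 3) (v $ 2) (v $ 1) (v $ 3) = ?G"
    "F (d $ 3) (d $ 2) (d $ 1) (v $ 3) (v $ 2) (v $ 1) = ?G"
    "F (d $ 1) (d $ 3) (d $ 2) (v $ 1) (v $ 3) (v $ 2) = ?G"
    by (rule swap[OF adm], rule trans[OF swap[OF adm'(1)] c1], rule trans[OF swap[OF adm'(2)] c2])
  have inj: "\<sigma> 1 \<noteq> \<sigma> 2" "\<sigma> 1 \<noteq> \<sigma> 3" "\<sigma> 2 \<noteq> \<sigma> 3"
    using bij_is_inj[OF assms(3)] by (simp_all add: inj_eq)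
  have "F (d $ \<sigma> 1) (d $ \<sigma> 2) (d $ \<sigma> 3) (v $ \<sigma> 1) (v $ \<sigma> 2) (v $ \<sigma> 3) =
      F (d $ 1) (d $ 2) (d $ 3) (v $ 1) (v $ 2) (v $ 3)"
    using exhaust_3[of "\<sigma> 1"] exhaust_3[of "\<sigma> 2"] exhaust_3[of "\<sigma> 3"] inj c1 c2 s
    by (elim disjE) (simp_all only: refl not_True_eq_False)
  then show ?thesis
    by (simp add: F_def perm vector_3_eta)
qed

theorem theorem5p2:
  fixes \<pp> :: "nat ^ 3 \<Rightarrow> poly3"
    and y x z :: poly3
    and d :: "nat ^ 3"
    and \<sigma> :: "3 \<Rightarrow> 3"
  assumes "\<And>d. admissible_triple d \<Longrightarrow> represents_central_function (\<pp> d) d"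
    and "y = Var 1" and "x = Var 2" and "z = Var 3"
    and "admissible_triple d"
    and "bij \<sigma>"
  shows "subst (\<pp> (permute_triple \<sigma> d)) (vector [y, x, z]) =
         subst (\<pp> d) (permute_triple (inv \<sigma>) (vector [y, x, z]))"
proof (rule eval_inject)
  fix v :: "complex ^ 3"
  have var: "vector [y, x, z] $ i = Var i" for i :: 3
    using exhaust_3[of i] assms(2-4) by auto
  have inverse: "permute_triple \<sigma> (permute_triple (inv \<sigma>) v) = v"
    using bij_is_inj[OF assms(6)] by (simp add: permute_triple_def vec_eq_iff)
  have "eval (subst (\<pp> (permute_triple \<sigma> d)) (vector [y, x, z])) v = eval (\<pp> (permute_triple \<sigma> d)) v"
    by (simp add: eval_subst var eval_Var)
  also have "\<dots> = eval (\<pp> d) (permute_triple (inv \<sigma>) v)"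
    using eval_permute[of \<pp> d \<sigma> "permute_triple (inv \<sigma>) v"] assms(1,5,6) by (simp add: inverse)
  also have "\<dots> = eval (subst (\<pp> d) (permute_triple (inv \<sigma>) (vector [y, x, z]))) v"
    by (simp add: eval_subst permute_triple_def var eval_Var)
  finally show "eval (subst (\<pp> (permute_triple \<sigma> d)) (vector [y, x, z])) v =
      eval (subst (\<pp> d) (permute_triple (inv \<sigma>) (vector [y, x, z]))) v" .
qed

end
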